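(* Let $F$ be a nonlattice distribution function on $[0,\infty)$ with $1-F(t)=t^{-2}L(t)$ for $t>0$, where $L$ is slowly varying at infinity, and assume $\mu_2<\infty$. Suppose further that $F$ admits a density $f$, and that the remainder $u(t)-1/\mu$ is ultimately monotone as $t\to\infty$, where $u=U'$ is the renewal density. Then $$u(t)=\frac{1}{\mu}+\frac{1}{\mu^2}\,\frac{L_2(t)}{t}\qquad\text{as } t\to\infty,$$ where $L_2$ is a function with $L_2(t)/L(t)\to1$ as $t\to\infty$.
   Context: $F$ is the common distribution function of nonnegative i.i.d. inter-arrival times, $\tau$ is a random variable with distribution function $F$; $\mu=\mathbb{E}\tau\in(0,\infty)$ and $\mu_2=\mathbb{E}\tau^2$. $F$ is nonlattice if it is not concentrated on a set $\{0,d,2d,\dots\}$ for any $d>0$. The renewal function is $U(t)=\sum_{n\ge 0}F^{*n}(t)$, where $F^{*n}$ is the $n$-fold convolution and $F^{*0}$ is the distribution function of the unit mass at $0$. When $F$ has a density $f$, $U$ is absolutely continuous apart from its unit atom at $0$, and its density $u=U'$ (the renewal density) satisfies the renewal equation $u(t)=f(t)+(f*u)(t)$, $t\ge0$. A measurable function $L:[0,\infty)\to[0,\infty)$ is slowly varying at infinity if $L(ct)/L(t)\to1$ as $t\to\infty$ for every fixed $c>0$. A function is ultimately monotone if it is monotone on $[t_0,\infty)$ for some $t_0$. *)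

theory Defs
  imports "HOL-Probability.Probability"
begin

text \<open>
  A distribution function \<open>F\<close> is represented by the corresponding Borel probability measure \<open>M\<close>
  on the line, so that \<open>F = cdf M\<close>.
\<close>

definition nonlattice :: "real measure \<Rightarrow> bool" where
  "nonlattice M \<longleftrightarrow> \<not> (\<exists>d>0. AE x in M. \<exists>k::nat. x = real k * d)"

primrec conv_power :: "real measure \<Rightarrow> nat \<Rightarrow> real measure" where
  "conv_power M 0 = return borel 0"
| "conv_power M (Suc n) = convolution M (conv_power M n)"

text \<open>The series converges whenever \<open>M\<close> is a probability measure on \<open>[0,\<infinity>)\<close> with \<open>M {0} < 1\<close>.\<close>

definition renewal_function :: "real measure \<Rightarrow> real \<Rightarrow> real" where
  "renewal_function M t = (\<Sum>n. cdf (conv_power M n) t)"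

text \<open>
  The summand \<open>1\<close> is the unit atom of the renewal measure at \<open>0\<close>.  A renewal density is determined
  only almost everywhere; the predicate admits every version, and values at negative arguments
  are irrelevant.
\<close>

definition renewal_density :: "real measure \<Rightarrow> (real \<Rightarrow> real) \<Rightarrow> bool" where
  "renewal_density M u \<longleftrightarrow>
     (\<forall>t\<ge>0. set_integrable lborel {0..t} u \<and>
            renewal_function M t = 1 + (LINT x:{0..t}|lborel. u x))"

definition slowly_varying :: "(real \<Rightarrow> real) \<Rightarrow> bool" where
  "slowly_varying L \<longleftrightarrow>
     set_borel_measurable borel {0..} L \<and> (\<forall>t\<ge>0. 0 \<le> L t) \<and>
     (\<forall>c>0. ((\<lambda>t. L (c * t) / L t) \<longlongrightarrow> 1) at_top)"

definition ultimately_monotone :: "(real \<Rightarrow> real) \<Rightarrow> bool" where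
  "ultimately_monotone g \<longleftrightarrow> (\<exists>t0. mono_on {t0..} g \<or> antimono_on {t0..} g)"

end

theory Submission
  imports Defs "HOL-Real_Asymp.Real_Asymp"
begin

text \<open>
  Write \<open>T = 1 - F\<close>, \<open>w = u - 1 / \<mu>\<close>, \<open>\<phi>(s) = E exp (- s \<tau>)\<close> and \<open>m(s) = E (\<tau> exp (- s \<tau>))\<close>.
  The claim is \<open>w(t) \<sim> L(t) / (\<mu>\<^sup>2 t)\<close>. Integrating \<open>w\<close> would lead to the slowly varying function
  \<open>t \<mapsto> \<integral>\<^sub>t\<^sup>\<infinity> L(x) / x dx\<close>, for which an asymptotic equivalence says nothing about the derivative.
  Everything is therefore done with \<open>x w(x)\<close>, whose integral over \<open>[0,t]\<close> is of the regularly varying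
  order \<open>t L(t)\<close>, and from which \<open>w\<close> can be recovered by monotonicity.
\<close>

text \<open>
  Expanding the renewal series and weighting with \<open>x\<close> gives
  \<open>\<integral> x exp (- s x) u(x) dx = \<Sum>n. (n + 1) \<phi>(s)^n m(s) = m(s) / (1 - \<phi>(s))\<^sup>2\<close>
  (\<open>Laplace_mult_renewal_density\<close>). With \<open>P(s) = (1 - \<phi>(s)) / s\<close> and
  \<open>\<Phi>(s) = \<integral> T(x) (1 - (1 + s x) exp (- s x)) dx = \<mu> - 2 P(s) + m(s)\<close> (\<open>expectation_erlang2_tail\<close>),
  subtracting the transform \<open>1 / (\<mu> s\<^sup>2)\<close> of \<open>x / \<mu>\<close> leaves the exact identity
  \<open>\<integral> x exp (- s x) w(x) dx = (\<mu> \<Phi>(s) - (\<mu> - P(s))\<^sup>2) / (\<mu> s\<^sup>2 P(s)\<^sup>2)\<close>.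
  A finite second moment makes \<open>\<mu> - P(s) = O(s)\<close> (\<open>Laplace_first_order\<close>), so the square is
  \<open>O(s\<^sup>2)\<close>, which is negligible against \<open>\<Phi>(s) \<sim> s L(1 / s)\<close>. The latter is an Abelian
  statement (\<open>Abelian_erlang2\<close>), proved by dominated convergence with a Potter bound for \<open>L\<close>; as
  \<open>L(t) = t\<^sup>2 T(t)\<close> with \<open>T\<close> monotone, that bound follows from the limit of the single ratio \<open>L(2 t) / L(t)\<close>.
\<close>

text \<open>
  Hence the transform of \<open>x w(x)\<close> at \<open>1 / t\<close> is \<open>\<sim> t L(t) / \<mu>\<^sup>2\<close>, and it remains to invert this
  (\<open>monotone_density_Laplace\<close>). As in Karamata's proof, Weierstrass approximation passes
  from the powers of \<open>exp (- x / t)\<close> to an arbitrary continuous function of it. A bump function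
  that sees only \<open>x\<close> between \<open>t\<close> and \<open>l t\<close>, or between \<open>t / l\<close> and \<open>t\<close>, compares the resulting
  average of \<open>x w(x)\<close> with \<open>t w(t)\<close> up to a factor \<open>l\<close>, and \<open>l\<close> tends to \<open>1\<close>.
\<close>

section \<open>A Tauberian theorem for ultimately monotone functions\<close>

lemma has_bochner_integral_lborel_scale:
  fixes h :: "real \<Rightarrow> real"
  assumes h: "has_bochner_integral lborel h I" and s: "s > 0"
  shows "has_bochner_integral lborel (\<lambda>x. h (s * x)) (I / s)"
  using h s lborel_integrable_real_affine[of h s 0] lborel_integral_real_affine[of s h 0]
  by (auto simp: has_bochner_integral_iff field_simps)

lemma has_bochner_integral_exp_Ici:
  assumes "s > 0"
  shows "has_bochner_integral lborel (\<lambda>x. exp (- (s * x)) * indicator {0..} x) (1 / s :: real)"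
proof -
  have "has_bochner_integral lborel (\<lambda>x::real. x ^ 0 * exp (- x) * indicator {0..} x) (fact 0)"
    by (rule has_bochner_integral_nn_integral)
       (use nn_intergal_power_times_exp_Ici[of 0] in
          \<open>auto simp: ennreal_mult'' simp flip: ennreal_indicator\<close>)
  from has_bochner_integral_lborel_scale[OF this assms]
  have "has_bochner_integral lborel (\<lambda>x. exp (- (s * x)) * indicator {0..} (s * x)) (1 / s)" by simp
  also have "(\<lambda>x. exp (- (s * x)) * indicator {0..} (s * x)) =
     (\<lambda>x. exp (- (s * x)) * indicator {0..} x :: real)"
    using assms by (auto simp: fun_eq_iff zero_le_mult_iff split: split_indicator)
  finally show ?thesis .
qed

lemma has_bochner_integral_mult_exp_Ici:
  assumes "s > 0"
  shows "has_bochner_integral lborel (\<lambda>x. x * exp (- (s * x)) * indicator {0..} x) (1 / s\<^sup>2 :: real)"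
proof -
  have "has_bochner_integral lborel (\<lambda>x::real. x ^ 1 * exp (- x) * indicator {0..} x) (fact 1)"
    by (rule has_bochner_integral_nn_integral)
       (use nn_intergal_power_times_exp_Ici[of 1] in
          \<open>auto simp: ennreal_mult'' simp flip: ennreal_indicator split: split_indicator\<close>)
  from has_bochner_integral_mult_right[OF has_bochner_integral_lborel_scale[OF this assms], of "1 / s"]
  have "has_bochner_integral lborel (\<lambda>x. (1 / s) * (s * x * exp (- (s * x)) * indicator {0..} (s * x))) ((1/s) * (1 / s))"
    by simp
  also have "(\<lambda>x. (1 / s) * (s * x * exp (- (s * x)) * indicator {0..} (s * x))) =
     (\<lambda>x. x * exp (- (s * x)) * indicator {0..} x :: real)"
    using assms by (auto simp: fun_eq_iff zero_le_mult_iff split: split_indicator)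
  finally show ?thesis by (simp add: power2_eq_square)
qed

text \<open>
  The substitution \<open>y = exp (- x)\<close> turns this into \<open>\<integral>\<^sub>0\<^sup>1 q(y) dy\<close>, the limit functional of Karamata's
  method; the exponential form makes it a special case of the integrals that converge to it.
\<close>

definition exp_test_integral :: "(real \<Rightarrow> real) \<Rightarrow> real" where
  "exp_test_integral q = (LINT x|lborel. exp (- x) * q (exp (- x)) * indicator {0..} x)"

lemma integrable_continuous_test:
  fixes g q :: "real \<Rightarrow> real"
  assumes "t > 0" and [measurable]: "g \<in> borel_measurable borel" and "\<And>x. x < 0 \<Longrightarrow> g x = 0"
    and int: "integrable lborel (\<lambda>x. exp (- (x / t)) * g x)"
    and q: "continuous_on UNIV q"
  shows "integrable lborel (\<lambda>x. exp (- (x / t)) * q (exp (- (x / t))) * g x)"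
proof -
  have [measurable]: "q \<in> borel_measurable borel"
    using q by (rule borel_measurable_continuous_onI)
  have "compact (q ` {0..1})"
    by (rule compact_continuous_image) (use q continuous_on_subset in auto)
  then obtain B where B: "\<And>y. y \<in> {0..1} \<Longrightarrow> norm (q y) \<le> B"
    by (meson bounded_iff compact_imp_bounded image_eqI)
  have B0: "B \<ge> 0" using B[of 0] by (auto intro: order_trans[OF norm_ge_zero])
  show ?thesis
  proof (rule Bochner_Integration.integrable_bound[OF integrable_mult_right[OF int, of B]])
    show "AE x in lborel. norm (exp (- (x / t)) * q (exp (- (x / t))) * g x) \<le> norm (B * (exp (- (x / t)) * g x))"
    proof (rule AE_I2)
      fix x :: real
      show "norm (exp (- (x / t)) * q (exp (- (x / t))) * g x) \<le> norm (B * (exp (- (x / t)) * g x))"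
      proof (cases "x < 0")
        case False
        hence "norm (q (exp (- (x / t)))) \<le> B" using \<open>t > 0\<close> by (intro B) auto
        hence "norm (q (exp (- (x / t)))) * \<bar>exp (- (x / t)) * g x\<bar> \<le> B * \<bar>exp (- (x / t)) * g x\<bar>"
          by (rule mult_right_mono) auto
        thus ?thesis using B0 by (simp add: abs_mult mult_ac)
      qed (use assms in auto)
    qed
  qed measurable
qed

lemma integrable_exp_test:
  assumes q: "continuous_on UNIV (q :: real \<Rightarrow> real)"
  shows "integrable lborel (\<lambda>x. exp (- x) * q (exp (- x)) * indicator {0..} x)"
  using integrable_continuous_test[of 1 "indicator {0..}" q] q has_bochner_integral_exp_Ici[of 1]
  by (auto simp: has_bochner_integral_iff)

text \<open>
  For \<open>q(y) = y^n\<close> the integral is the Laplace transform at \<open>(n + 1) / t\<close>, and regular variation of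
  index \<open>1\<close> gives the limit \<open>A / (n + 1)\<close>. Linearity extends this to polynomials. Since \<open>g \<ge> 0\<close>, a uniform
  error \<open>e\<close> in \<open>q\<close> costs at most \<open>e\<close> times the Laplace transform itself, so the polynomials
  of Weierstrass' theorem suffice for every continuous \<open>q\<close>.
\<close>

lemma Laplace_limit_continuous_test:
  fixes g r q :: "real \<Rightarrow> real"
  assumes g[measurable]: "g \<in> borel_measurable borel" and nonneg: "\<And>x. 0 \<le> g x"
    and g0: "\<And>x. x < 0 \<Longrightarrow> g x = 0"
    and int: "\<And>t. t > 0 \<Longrightarrow> integrable lborel (\<lambda>x. exp (- (x / t)) * g x)"
    and lim: "((\<lambda>t. (LINT x|lborel. exp (- (x / t)) * g x) / r t) \<longlongrightarrow> A) at_top"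
    and rv: "\<And>c. c > 0 \<Longrightarrow> ((\<lambda>t. r (c * t) / r t) \<longlongrightarrow> c) at_top"
    and pos: "\<forall>\<^sub>F t in at_top. r t > 0"
    and q: "continuous_on UNIV q"
  shows "((\<lambda>t. (LINT x|lborel. exp (- (x / t)) * q (exp (- (x / t))) * g x) / r t)
           \<longlongrightarrow> A * exp_test_integral q) at_top"
proof -
  define G where "G t = (LINT x|lborel. exp (- (x / t)) * g x)" for t
  define J where "J p t = (LINT x|lborel. exp (- (x / t)) * p (exp (- (x / t))) * g x) / r t" for p t
  have G0: "G t \<ge> 0" for t
    unfolding G_def by (rule integral_nonneg_AE) (simp add: nonneg)
  have limG: "((\<lambda>t. G t / r t) \<longlongrightarrow> A) at_top" using lim unfolding G_def .
  have A0: "A \<ge> 0"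
    by (rule tendsto_lowerbound[OF limG]) (use pos in \<open>auto elim!: eventually_mono simp: G0\<close>)
  have scale: "((\<lambda>t. G (c * t) / r t) \<longlongrightarrow> c * A) at_top" if c: "c > 0" for c
  proof -
    have ct: "filterlim (\<lambda>t::real. c * t) at_top at_top"
      using c by (rule filterlim_tendsto_pos_mult_at_top[OF tendsto_const _ filterlim_ident])
    have "((\<lambda>t. (r (c * t) / r t) * (G (c * t) / r (c * t))) \<longlongrightarrow> c * A) at_top"
      by (intro tendsto_mult rv c filterlim_compose[OF limG ct])
    moreover have "\<forall>\<^sub>F t in at_top. r (c * t) > 0"
      using eventually_compose_filterlim[OF pos ct] .
    hence "\<forall>\<^sub>F t in at_top. (r (c * t) / r t) * (G (c * t) / r (c * t)) = G (c * t) / r t"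
      by eventually_elim simp
    ultimately show ?thesis by (rule Lim_transform_eventually)
  qed
  have mono: "exp (- (x / t)) * exp (- (x / t)) ^ n = exp (- (x / (1 / (1 + real n) * t)))" if "t > 0" for x t :: real and n
  proof -
    have "exp (- (x / t)) * exp (- (x / t)) ^ n = exp (- (x / t)) ^ Suc n" by simp
    also have "\<dots> = exp (real (Suc n) * (- (x / t)))" by (rule exp_of_nat_mult[symmetric])
    also have "real (Suc n) * (- (x / t)) = - (x / (1 / (1 + real n) * t))" by (simp add: field_simps)
    finally show ?thesis .
  qed
  have poly: "(J p \<longlongrightarrow> A * exp_test_integral p) at_top" if rp: "real_polynomial_function p" for p
  proof -
    obtain a n where p: "p = (\<lambda>x. \<Sum>i\<le>n. a i * x ^ i)"
      using rp by (auto simp: real_polynomial_function_iff_sum)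
    have L: "exp_test_integral p = (\<Sum>i\<le>n. a i * (1 / (1 + real i)))"
    proof -
      have e: "exp (- x) * p (exp (- x)) * indicator {0..} x =
          (\<Sum>i\<le>n. a i * (exp (- ((1 + real i) * x)) * indicator {0..} x))" for x
        using mono[of 1 x] unfolding p
        by (auto simp: sum_distrib_left sum_distrib_right algebra_simps intro!: sum.cong split: split_indicator)
      have "has_bochner_integral lborel (\<lambda>x. \<Sum>i\<le>n. a i * (exp (- ((1 + real i) * x)) * indicator {0..} x))
          (\<Sum>i\<le>n. a i * (1 / (1 + real i)))"
        by (intro has_bochner_integral_sum has_bochner_integral_mult_right has_bochner_integral_exp_Ici) auto
      thus ?thesis unfolding exp_test_integral_def e by (simp add: has_bochner_integral_iff)
    qed
    have ev: "\<forall>\<^sub>F t in at_top. (\<Sum>i\<le>n. a i * (G (1 / (1 + real i) * t) / r t)) = J p t"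
      using eventually_gt_at_top[of 0]
    proof eventually_elim
      case (elim t)
      have e: "exp (- (x / t)) * p (exp (- (x / t))) * g x =
          (\<Sum>i\<le>n. a i * (exp (- (x / (1 / (1 + real i) * t))) * g x))" for x
        unfolding mono[OF elim, symmetric] p
        by (auto simp: sum_distrib_left sum_distrib_right algebra_simps intro!: sum.cong)
      have "has_bochner_integral lborel (\<lambda>x. \<Sum>i\<le>n. a i * (exp (- (x / (1 / (1 + real i) * t))) * g x))
          (\<Sum>i\<le>n. a i * G (1 / (1 + real i) * t))"
        unfolding G_def using elim
        by (intro has_bochner_integral_sum has_bochner_integral_mult_right has_bochner_integral_integrable int) auto
      thus ?case unfolding J_def e
        by (simp add: has_bochner_integral_iff sum_divide_distrib)
    qed
    have "((\<lambda>t. \<Sum>i\<le>n. a i * (G (1 / (1 + real i) * t) / r t)) \<longlongrightarrow> (\<Sum>i\<le>n. a i * (1 / (1 + real i) * A))) at_top"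
      by (intro tendsto_sum tendsto_mult tendsto_const scale) auto
    hence "(J p \<longlongrightarrow> (\<Sum>i\<le>n. a i * (1 / (1 + real i) * A))) at_top"
      using ev by (rule Lim_transform_eventually)
    also have "(\<Sum>i\<le>n. a i * (1 / (1 + real i) * A)) = A * exp_test_integral p"
      by (simp add: L sum_distrib_left mult_ac)
    finally show ?thesis .
  qed
  show ?thesis unfolding J_def[symmetric]
  proof (rule tendstoI)
    fix \<epsilon> :: real assume \<epsilon>: "\<epsilon> > 0"
    \<comment> \<open>Replacing \<open>q\<close> by \<open>p\<close> costs at most \<open>e (A + 1)\<close> before the limit and \<open>e A\<close> in the limit.\<close>
    define e where "e = \<epsilon> / (2 * (2 * A + 2))"
    have e: "e > 0" unfolding e_def using \<epsilon> A0 by simp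
    obtain p where p: "real_polynomial_function p" and pq: "\<And>x. x \<in> {0..1} \<Longrightarrow> \<bar>q x - p x\<bar> < e"
      using Stone_Weierstrass_real_polynomial_function[of "{0..1}" q e] continuous_on_subset[OF q] e by auto
    have pc: "continuous_on UNIV p" 
      using p by (simp add: continuous_at_imp_continuous_on continuous_real_polymonial_function)
    have Lpq: "\<bar>exp_test_integral q - exp_test_integral p\<bar> \<le> e"
    proof -
      have "exp_test_integral q - exp_test_integral p = (LINT x|lborel. exp (- x) * q (exp (- x)) * indicator {0..} x - exp (- x) * p (exp (- x)) * indicator {0..} x)"
        unfolding exp_test_integral_def
        by (rule Bochner_Integration.integral_diff[symmetric]) (intro integrable_exp_test q pc)+
      hence "\<bar>exp_test_integral q - exp_test_integral p\<bar> = norm (LINT x|lborel. exp (- x) * q (exp (- x)) * indicator {0..} x - exp (- x) * p (exp (- x)) * indicator {0..} x)"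
        by simp
      also have "\<dots> \<le> (LINT x|lborel. e * (exp (- (1 * x)) * indicator {0..} x))"
      proof (rule Bochner_Integration.integral_norm_bound_integral)
        show "norm (exp (- x) * q (exp (- x)) * indicator {0..} x - exp (- x) * p (exp (- x)) * indicator {0..} x)
              \<le> e * (exp (- (1 * x)) * indicator {0..} x)" for x :: real
        proof (cases "x \<ge> 0")
          case True
          hence "\<bar>q (exp (- x)) - p (exp (- x))\<bar> \<le> e" by (intro less_imp_le pq) auto
          hence "\<bar>q (exp (- x)) - p (exp (- x))\<bar> * exp (- x) \<le> e * exp (- x)" by simp
          also have "\<bar>q (exp (- x)) - p (exp (- x))\<bar> * exp (- x) = \<bar>exp (- x) * q (exp (- x)) - exp (- x) * p (exp (- x))\<bar>"
            by (simp add: abs_mult flip: right_diff_distrib)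
          finally show ?thesis using True by simp
        qed auto
      qed (use has_bochner_integral_exp_Ici[of 1] in \<open>auto simp: has_bochner_integral_iff intro!: integrable_exp_test q pc Bochner_Integration.integrable_diff\<close>)
      also have "\<dots> = e" using has_bochner_integral_exp_Ici[of 1] by (simp add: has_bochner_integral_iff)
      finally show ?thesis by simp
    qed
    have J: "\<bar>J q t - J p t\<bar> \<le> e * (G t / r t)" if t: "t > 0" "r t > 0" for t
    proof -
      note iq = integrable_continuous_test[OF t(1) g g0 int[OF t(1)] q]
      note ip = integrable_continuous_test[OF t(1) g g0 int[OF t(1)] pc]
      have "J q t - J p t = (LINT x|lborel. exp (- (x/t)) * q (exp (- (x/t))) * g x - exp (- (x/t)) * p (exp (- (x/t))) * g x) / r t"
        unfolding J_def diff_divide_distrib[symmetric]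
        by (subst Bochner_Integration.integral_diff[OF iq ip]) simp_all
      hence "\<bar>J q t - J p t\<bar> = norm (LINT x|lborel. exp (- (x/t)) * q (exp (- (x/t))) * g x - exp (- (x/t)) * p (exp (- (x/t))) * g x) / r t"
        using t by simp
      also have "\<dots> \<le> (LINT x|lborel. e * (exp (- (x/t)) * g x)) / r t"
      proof (intro divide_right_mono Bochner_Integration.integral_norm_bound_integral)
        show "norm (exp (- (x/t)) * q (exp (- (x/t))) * g x - exp (- (x/t)) * p (exp (- (x/t))) * g x)
              \<le> e * (exp (- (x/t)) * g x)" for x :: real
        proof (cases "x \<ge> 0")
          case True
          hence "\<bar>q (exp (- (x/t))) - p (exp (- (x/t)))\<bar> \<le> e" using t by (intro less_imp_le pq) auto
          hence "\<bar>q (exp (- (x/t))) - p (exp (- (x/t)))\<bar> * (exp (- (x/t)) * g x) \<le> e * (exp (- (x/t)) * g x)"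
            by (intro mult_right_mono) (auto simp: nonneg)
          also have "\<bar>q (exp (- (x/t))) - p (exp (- (x/t)))\<bar> * (exp (- (x/t)) * g x) = \<bar>(q (exp (- (x/t))) - p (exp (- (x/t)))) * (exp (- (x/t)) * g x)\<bar>"
            by (simp add: abs_mult nonneg)
          finally show ?thesis by (simp add: algebra_simps)
        qed (use g0 in auto)
        show "integrable lborel (\<lambda>x. exp (- (x/t)) * q (exp (- (x/t))) * g x - exp (- (x/t)) * p (exp (- (x/t))) * g x)"
          by (rule Bochner_Integration.integrable_diff[OF iq ip])
        show "integrable lborel (\<lambda>x. e * (exp (- (x/t)) * g x))"
          by (intro integrable_mult_right int t)
      qed (use t in simp)
      also have "\<dots> = e * (G t / r t)" unfolding G_def by simp
      finally show ?thesis .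
    qed
    have e1: "\<forall>\<^sub>F t in at_top. G t / r t < A + 1" by (rule order_tendstoD[OF limG]) simp
    have e2: "\<forall>\<^sub>F t in at_top. dist (J p t) (A * exp_test_integral p) < \<epsilon> / 2"
      by (rule tendstoD[OF poly[OF p]]) (use \<epsilon> in simp)
    show "\<forall>\<^sub>F t in at_top. dist (J q t) (A * exp_test_integral q) < \<epsilon>"
      using e1 e2 pos eventually_gt_at_top[of 0]
    proof eventually_elim
      case (elim t)
      have "\<bar>J q t - J p t\<bar> \<le> e * (A + 1)"
        using J[of t] mult_left_mono[of "G t / r t" "A + 1" e] elim e by linarith
      moreover have "\<bar>A * exp_test_integral q - A * exp_test_integral p\<bar> \<le> e * A"
        using mult_left_mono[OF Lpq A0] A0 by (simp add: abs_mult mult_ac flip: right_diff_distrib)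
      moreover have "e * (A + 1) + e * A < \<epsilon> / 2"
      proof -
        have "e * (2 * A + 2) = \<epsilon> / 2" unfolding e_def using A0 by (simp add: field_simps)
        thus ?thesis using e by (simp add: algebra_simps)
      qed
      ultimately show ?case using elim(2) unfolding dist_real_def by linarith
    qed
  qed
qed

text \<open>
  As a function of \<open>x\<close>, \<open>exp_tent a b (exp (- x))\<close> is a continuous bump on the interval \<open>(a, b)\<close>.
  It takes the place of an indicator function, which could be approximated only in the mean.
\<close>

definition exp_tent :: "real \<Rightarrow> real \<Rightarrow> real \<Rightarrow> real" where
  "exp_tent a b y = max 0 ((y - exp (- b)) * (exp (- a) - y))"

lemma continuous_exp_tent: "continuous_on UNIV (exp_tent a b)"
  unfolding exp_tent_def by (intro continuous_intros)

lemma exp_tent_nonneg: "0 \<le> exp_tent a b y"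
  by (simp add: exp_tent_def)

lemma exp_tent_exp_pos_iff:
  assumes "a < b"
  shows "0 < exp_tent a b (exp (- x)) \<longleftrightarrow> a < x \<and> x < b"
  using assms by (auto simp: exp_tent_def zero_less_mult_iff less_max_iff_disj)

lemma exp_test_integral_tent_pos:
  assumes "0 \<le> a" "a < b"
  shows "0 < exp_test_integral (exp_tent a b)"
proof -
  let ?h = "\<lambda>x. exp (- x) * exp_tent a b (exp (- x)) * indicator {0..} x"
  have "0 \<le> exp_test_integral (exp_tent a b)"
    unfolding exp_test_integral_def
    by (rule integral_nonneg_AE) (auto simp: exp_tent_nonneg)
  moreover have "exp_test_integral (exp_tent a b) \<noteq> 0"
  proof
    assume "exp_test_integral (exp_tent a b) = 0"
    hence "AE x in lborel. ?h x = 0"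
      unfolding exp_test_integral_def
      by (subst (asm) integral_nonneg_eq_0_iff_AE)
         (auto simp: exp_tent_nonneg intro!: integrable_exp_test continuous_exp_tent)
    hence "AE x in lborel. x \<notin> {a<..<b}"
    proof eventually_elim
      case (elim x)
      show ?case
      proof
        assume x: "x \<in> {a<..<b}"
        hence "exp_tent a b (exp (- x)) > 0" using exp_tent_exp_pos_iff[OF assms(2), of x] by simp
        thus False using elim x assms(1) by simp
      qed
    qed
    hence "emeasure lborel {a<..<b} = 0" by (subst (asm) AE_iff_measurable[of "{a<..<b}"]) auto
    thus False using assms(2) by simp
  qed
  ultimately show ?thesis by simp
qed

lemma
  fixes g :: "real \<Rightarrow> real"
  assumes t: "t > 0" and ab: "0 \<le> a" "a < b" and g: "g \<in> borel_measurable borel" "\<And>x. x < 0 \<Longrightarrow> g x = 0"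
    and int: "integrable lborel (\<lambda>x. exp (- (x / t)) * g x)"
  defines "J \<equiv> (LINT x|lborel. exp (- (x / t)) * exp_tent a b (exp (- (x / t))) * g x)"
  shows tent_integral_le:
      "(\<And>x. a * t < x \<Longrightarrow> x < b * t \<Longrightarrow> g x \<le> B) \<Longrightarrow> J \<le> B * t * exp_test_integral (exp_tent a b)"
    and tent_integral_ge:
      "(\<And>x. a * t < x \<Longrightarrow> x < b * t \<Longrightarrow> B \<le> g x) \<Longrightarrow> B * t * exp_test_integral (exp_tent a b) \<le> J"
proof -
  let ?q = "exp_tent a b"
  define h where "h x = exp (- x) * ?q (exp (- x)) * indicator {0..} x" for x :: real
  have h: "has_bochner_integral lborel h (exp_test_integral ?q)"
    unfolding h_def exp_test_integral_def
    by (intro has_bochner_integral_integrable integrable_exp_test continuous_exp_tent)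
  have hB: "has_bochner_integral lborel (\<lambda>x. B * h (1 / t * x)) (B * (exp_test_integral ?q / (1 / t)))"
    by (intro has_bochner_integral_mult_right has_bochner_integral_lborel_scale h) (use t in auto)
  have J: "has_bochner_integral lborel (\<lambda>x. exp (- (x / t)) * ?q (exp (- (x / t))) * g x) J"
    unfolding J_def by (intro has_bochner_integral_integrable integrable_continuous_test assms continuous_exp_tent)
  have supp: "a * t < x \<and> x < b * t" if "?q (exp (- (x / t))) \<noteq> 0" for x
  proof -
    have "a < x / t \<and> x / t < b"
      using exp_tent_exp_pos_iff[OF ab(2), of "x / t"] exp_tent_nonneg[of a b "exp (- (x / t))"] that by linarith
    thus ?thesis using t by (simp add: field_simps)
  qed
  have h': "h (1 / t * x) = exp (- (x / t)) * ?q (exp (- (x / t)))" for x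
    using supp[of x] t mult_nonneg_nonneg[OF ab(1), of t]
    by (cases "?q (exp (- (x / t))) = 0") (auto simp: h_def)
  show "J \<le> B * t * exp_test_integral ?q" if "\<And>x. a * t < x \<Longrightarrow> x < b * t \<Longrightarrow> g x \<le> B"
  proof -
    have "exp (- (x / t)) * ?q (exp (- (x / t))) * g x \<le> B * h (1 / t * x)" for x
    proof (cases "?q (exp (- (x / t))) = 0")
      case False
      hence "g x \<le> B" using supp that by blast
      thus ?thesis unfolding h' using mult_left_mono[of "g x" B "exp (- (x / t)) * ?q (exp (- (x / t)))"]
        by (simp add: exp_tent_nonneg mult_ac)
    qed (use h'[of x] in simp)
    thus ?thesis
      using integral_mono[OF integrable.intros[OF J] integrable.intros[OF hB]]
        has_bochner_integral_integral_eq[OF J] has_bochner_integral_integral_eq[OF hB] by (auto simp: mult_ac)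
  qed
  show "B * t * exp_test_integral ?q \<le> J" if "\<And>x. a * t < x \<Longrightarrow> x < b * t \<Longrightarrow> B \<le> g x"
  proof -
    have "B * h (1 / t * x) \<le> exp (- (x / t)) * ?q (exp (- (x / t))) * g x" for x
    proof (cases "?q (exp (- (x / t))) = 0")
      case False
      hence "B \<le> g x" using supp that by blast
      thus ?thesis unfolding h' using mult_left_mono[of B "g x" "exp (- (x / t)) * ?q (exp (- (x / t)))"]
        by (simp add: exp_tent_nonneg mult_ac)
    qed (use h'[of x] in simp)
    thus ?thesis
      using integral_mono[OF integrable.intros[OF hB] integrable.intros[OF J]]
        has_bochner_integral_integral_eq[OF J] has_bochner_integral_integral_eq[OF hB] by (auto simp: mult_ac)
  qed
qed

lemma ultimately_monotone_constant_sign: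
  fixes w :: "real \<Rightarrow> real"
  assumes "mono_on {t0..} w \<or> antimono_on {t0..} w"
  shows "\<exists>t1\<ge>t0. (\<forall>x\<ge>t1. 0 \<le> w x) \<or> (\<forall>x\<ge>t1. w x \<le> 0)"
proof (cases "mono_on {t0..} w")
  case True
  hence m: "w x \<le> w y" if "t0 \<le> x" "x \<le> y" for x y using that by (auto simp: monotone_on_def)
  show ?thesis
  proof (cases "\<exists>x\<ge>t0. 0 \<le> w x")
    case True
    then obtain x where "x \<ge> t0" "0 \<le> w x" by auto
    thus ?thesis using m[of x] by (intro exI[of _ x]) force
  qed (force intro: exI[of _ t0])
next
  case False
  hence "antimono_on {t0..} w" using assms by auto
  hence m: "w y \<le> w x" if "t0 \<le> x" "x \<le> y" for x y using that by (auto simp: monotone_on_def)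
  show ?thesis
  proof (cases "\<exists>x\<ge>t0. w x \<le> 0")
    case True
    then obtain x where "x \<ge> t0" "w x \<le> 0" by auto
    thus ?thesis using m[of x] by (intro exI[of _ x]) force
  qed (force intro: exI[of _ t0])
qed

text \<open>
  A monotone \<open>w\<close> has ultimately constant sign, and the sign is \<open>+\<close>: otherwise the Laplace transform
  would stay bounded above, although it is asymptotic to \<open>A r(t)\<close> with \<open>r(t)\<close> tending to \<open>\<infinity>\<close>. So \<open>x w(x)\<close> may be
  replaced by a nonnegative function \<open>g\<close> vanishing on an initial interval. On \<open>(t, l t)\<close>
  and on \<open>(t / l, t)\<close> the factor \<open>x\<close> differs from \<open>t\<close> by at most the factor \<open>l\<close>, and \<open>w(x)\<close> lies on one
  side of \<open>w(t)\<close>. Whichever direction \<open>w\<close> has, one of the two intervals yields the upper bound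
  for \<open>w(t)\<close> and the other the lower bound.
\<close>

theorem monotone_density_Laplace:
  fixes w r :: "real \<Rightarrow> real"
  assumes int: "\<And>t. t > 0 \<Longrightarrow> integrable lborel (\<lambda>x. exp (- (x / t)) * (x * w x * indicator {0..} x))"
    and lim: "((\<lambda>t. (LINT x|lborel. exp (- (x / t)) * (x * w x * indicator {0..} x)) / r t) \<longlongrightarrow> A) at_top"
    and A: "A > 0"
    and rv: "\<And>c. c > 0 \<Longrightarrow> ((\<lambda>t. r (c * t) / r t) \<longlongrightarrow> c) at_top"
    and r: "filterlim r at_top at_top"
    and mono: "mono_on {t0..} w \<or> antimono_on {t0..} w"
  shows "((\<lambda>t. t\<^sup>2 * w t / r t) \<longlongrightarrow> A) at_top"
proof -
  obtain t0' where t0': "t0' \<ge> t0" and sgn0: "(\<forall>x\<ge>t0'. 0 \<le> w x) \<or> (\<forall>x\<ge>t0'. w x \<le> 0)"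
    using ultimately_monotone_constant_sign[OF mono] by blast
  define t1 where "t1 = max t0' 1"
  have t1: "t1 \<ge> t0" "t1 > 0" unfolding t1_def using t0' by auto
  have sgn: "(\<forall>x\<ge>t1. 0 \<le> w x) \<or> (\<forall>x\<ge>t1. w x \<le> 0)" using sgn0 unfolding t1_def by auto
  have rpos: "\<forall>\<^sub>F t in at_top. r t > 0" using r by (simp add: filterlim_at_top_dense)
  define h where "h x = x * w x * indicator {0..} x" for x
  define g where "g x = h x * indicator {t1..} x" for x
  have g_eq: "g x = (if x \<ge> t1 then x * w x else 0)" for x
    unfolding g_def h_def using t1 by (auto split: split_indicator)
  have inth: "integrable lborel (\<lambda>x. exp (- (x / t)) * h x)" if "t > 0" for t
    using int[OF that] unfolding h_def .
  have [measurable]: "h \<in> borel_measurable borel"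
  proof -
    have k: "(\<lambda>x. exp (- x) * h x) \<in> borel_measurable borel"
      using borel_measurable_integrable[OF inth[of 1]] by simp
    have "(\<lambda>x. exp x * (exp (- x) * h x)) \<in> borel_measurable borel"
      by (intro borel_measurable_times k) measurable
    also have "(\<lambda>x. exp x * (exp (- x) * h x)) = h"
      by (simp add: fun_eq_iff exp_minus)
    finally show ?thesis .
  qed
  have gm[measurable]: "g \<in> borel_measurable borel" unfolding g_def by measurable
  have intg: "integrable lborel (\<lambda>x. exp (- (x / t)) * g x)" if "t > 0" for t
    by (rule Bochner_Integration.integrable_bound[OF inth[OF that]])
       (auto simp: g_def split: split_indicator)
  define C where "C = (LINT x|lborel. exp (- (x / 1)) * \<bar>h x\<bar>) * exp t1"
  \<comment> \<open>Cutting off the initial interval changes the transform by a bounded amount only.\<close>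
  have C: "\<bar>(LINT x|lborel. exp (- (x / t)) * h x) - (LINT x|lborel. exp (- (x / t)) * g x)\<bar> \<le> C" if t: "t \<ge> 1" for t
  proof -
    have i1: "integrable lborel (\<lambda>x. exp (- (x / 1)) * \<bar>h x\<bar>)"
      using integrable_abs[OF inth[of 1]] by (simp add: abs_mult)
    have "(LINT x|lborel. exp (- (x / t)) * h x) - (LINT x|lborel. exp (- (x / t)) * g x)
        = (LINT x|lborel. exp (- (x / t)) * h x - exp (- (x / t)) * g x)"
      by (rule Bochner_Integration.integral_diff[symmetric]) (use inth intg t in auto)
    hence "\<bar>(LINT x|lborel. exp (- (x / t)) * h x) - (LINT x|lborel. exp (- (x / t)) * g x)\<bar>
        = norm (LINT x|lborel. exp (- (x / t)) * h x - exp (- (x / t)) * g x)" by simp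
    also have "\<dots> \<le> (LINT x|lborel. (exp (- (x / 1)) * \<bar>h x\<bar>) * exp t1)"
    proof (rule Bochner_Integration.integral_norm_bound_integral)
      show "norm (exp (- (x / t)) * h x - exp (- (x / t)) * g x) \<le> (exp (- (x / 1)) * \<bar>h x\<bar>) * exp t1" for x
      proof (cases "0 \<le> x \<and> x < t1")
        case True
        have "exp (- (x / t)) \<le> 1" using True t by simp
        also have "1 \<le> exp (- (x / 1)) * exp t1" using True by (simp flip: exp_add)
        finally have "exp (- (x / t)) * \<bar>h x\<bar> \<le> (exp (- (x / 1)) * exp t1) * \<bar>h x\<bar>"
          by (rule mult_right_mono) simp
        thus ?thesis using True by (simp add: g_def abs_mult mult_ac)
      next
        case False
        hence "h x = g x" by (auto simp: h_def g_def)
        thus ?thesis by simp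
      qed
    qed (use i1 in \<open>auto intro!: Bochner_Integration.integrable_diff inth intg simp del: div_by_1\<close>, use t in auto)
    also have "\<dots> = C" unfolding C_def using i1 by simp
    finally show ?thesis by simp
  qed
  have limC: "((\<lambda>t. C / r t) \<longlongrightarrow> 0) at_top"
    by (rule real_tendsto_divide_at_top[OF tendsto_const r])
  have limg: "((\<lambda>t. (LINT x|lborel. exp (- (x / t)) * g x) / r t) \<longlongrightarrow> A) at_top"
  proof -
    have "((\<lambda>t. (LINT x|lborel. exp (- (x / t)) * h x) / r t - (LINT x|lborel. exp (- (x / t)) * g x) / r t) \<longlongrightarrow> 0) at_top"
    proof (rule Lim_null_comparison[OF _ limC])
      show "\<forall>\<^sub>F t in at_top. norm ((LINT x|lborel. exp (- (x / t)) * h x) / r t - (LINT x|lborel. exp (- (x / t)) * g x) / r t) \<le> C / r t"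
        using rpos eventually_ge_at_top[of 1]
      proof eventually_elim
        case (elim t)
        show ?case using C[OF elim(2)] elim by (simp add: abs_divide divide_right_mono flip: diff_divide_distrib)
      qed
    qed
    from tendsto_diff[OF lim this] show ?thesis by (simp add: h_def)
  qed
  have wpos: "0 \<le> w x" if "x \<ge> t1" for x
  proof -
    have "\<not> (\<forall>x\<ge>t1. w x \<le> 0)"
    proof
      assume *: "\<forall>x\<ge>t1. w x \<le> 0"
      have "(LINT x|lborel. exp (- (x / t)) * g x) \<le> 0" for t
      proof -
        have "0 \<le> (LINT x|lborel. - (exp (- (x / t)) * g x))"
          by (rule integral_nonneg_AE) (use * t1 in \<open>auto simp: g_eq mult_le_0_iff\<close>)
        thus ?thesis by simp
      qed
      hence "\<forall>\<^sub>F t in at_top. (LINT x|lborel. exp (- (x / t)) * g x) / r t \<le> 0"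
        using rpos by (auto elim!: eventually_mono simp: divide_le_0_iff)
      from tendsto_upperbound[OF limg this] A show False by simp
    qed
    thus ?thesis using sgn that by blast
  qed
  have g_nonneg: "0 \<le> g x" for x using wpos t1 by (auto simp: g_eq)
  have g_0: "g x = 0" if "x < 0" for x using that by (simp add: g_def h_def)
  define J where "J a b t = (LINT x|lborel. exp (- (x / t)) * exp_tent a b (exp (- (x / t))) * g x)" for a b t
  define \<Lambda> where "\<Lambda> a b = exp_test_integral (exp_tent a b)" for a b
  have limJ: "((\<lambda>t. J a b t / r t) \<longlongrightarrow> A * \<Lambda> a b) at_top" for a b
    unfolding J_def \<Lambda>_def
    by (rule Laplace_limit_continuous_test[OF gm g_nonneg g_0 intg limg rv rpos continuous_exp_tent])
  have limJ': "((\<lambda>t. c * (J a b t / r t / \<Lambda> a b)) \<longlongrightarrow> c * A) at_top" if "0 \<le> a" "a < b" for a b c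
  proof -
    have L: "\<Lambda> a b > 0" using exp_test_integral_tent_pos[OF that] unfolding \<Lambda>_def .
    have "((\<lambda>t. c * (J a b t / r t / \<Lambda> a b)) \<longlongrightarrow> c * (A * \<Lambda> a b / \<Lambda> a b)) at_top"
      using L by (intro tendsto_intros limJ) simp
    thus ?thesis using L by simp
  qed
  have bounds: "(\<exists>a b. 0 \<le> a \<and> a < b \<and> (\<forall>\<^sub>F t in at_top. t\<^sup>2 * w t / r t \<le> l * (J a b t / r t / \<Lambda> a b))) \<and>
                (\<exists>a b. 0 \<le> a \<and> a < b \<and> (\<forall>\<^sub>F t in at_top. (1 / l) * (J a b t / r t / \<Lambda> a b) \<le> t\<^sup>2 * w t / r t))"
    if l: "l > 1" for l
  proof -
    have upper: "t\<^sup>2 * w t / r t \<le> l * (J a b t / r t / \<Lambda> a b)"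
      if "0 \<le> a" "a < b" "t > 0" "r t > 0" and le: "\<And>x. a * t < x \<Longrightarrow> x < b * t \<Longrightarrow> t * w t / l \<le> g x" for a b t
    proof -
      have L: "\<Lambda> a b > 0" unfolding \<Lambda>_def by (rule exp_test_integral_tent_pos) fact+
      have "t * w t / l * t * \<Lambda> a b \<le> J a b t"
        unfolding J_def \<Lambda>_def by (rule tent_integral_ge) (fact gm g_0 intg[OF \<open>t > 0\<close>] that)+
      hence "t\<^sup>2 * w t \<le> l * (J a b t / \<Lambda> a b)"
        using L l by (simp add: field_simps power2_eq_square)
      hence "t\<^sup>2 * w t / r t \<le> l * (J a b t / \<Lambda> a b) / r t" using that by (intro divide_right_mono) auto
      thus ?thesis by (simp add: mult_ac)
    qed
    have lower: "(1 / l) * (J a b t / r t / \<Lambda> a b) \<le> t\<^sup>2 * w t / r t"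
      if "0 \<le> a" "a < b" "t > 0" "r t > 0" and le: "\<And>x. a * t < x \<Longrightarrow> x < b * t \<Longrightarrow> g x \<le> l * (t * w t)" for a b t
    proof -
      have L: "\<Lambda> a b > 0" unfolding \<Lambda>_def by (rule exp_test_integral_tent_pos) fact+
      have "J a b t \<le> l * (t * w t) * t * \<Lambda> a b"
        unfolding J_def \<Lambda>_def by (rule tent_integral_le) (fact gm g_0 intg[OF \<open>t > 0\<close>] that)+
      hence "(1 / l) * (J a b t / \<Lambda> a b) \<le> t\<^sup>2 * w t"
        using L l by (simp add: field_simps power2_eq_square)
      hence "(1 / l) * (J a b t / \<Lambda> a b) / r t \<le> t\<^sup>2 * w t / r t" using that by (intro divide_right_mono) auto
      thus ?thesis by (simp add: mult_ac)
    qed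
    \<comment> \<open>From here on even \<open>t / l\<close> lies in the region where \<open>w\<close> is monotone and nonnegative.\<close>
    have large: "\<forall>\<^sub>F t in at_top. t \<ge> l * t1 \<and> r t > 0"
      using rpos eventually_ge_at_top[of "l * t1"] by eventually_elim auto
    have lt: "t > 0" "t \<ge> t1" if "t \<ge> l * t1" for t
    proof -
      have "1 * t1 \<le> l * t1" using l t1 by (intro mult_right_mono) auto
      thus "t \<ge> t1" using that by simp
      thus "t > 0" using t1 by simp
    qed
    have xt: "x \<ge> t1" if "t \<ge> l * t1" "1 / l * t < x" for x t
    proof -
      have "t < l * x" using that l by (simp add: field_simps)
      hence "l * t1 < l * x" using that by simp
      thus ?thesis using l by simp
    qed
    show ?thesis
    proof (cases "mono_on {t0..} w")
      case True
      hence m: "w x \<le> w y" if "t1 \<le> x" "x \<le> y" for x y using that t1 by (auto simp: monotone_on_def)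
      have "\<forall>\<^sub>F t in at_top. t\<^sup>2 * w t / r t \<le> l * (J 1 l t / r t / \<Lambda> 1 l)"
        using large
      proof eventually_elim
        case (elim t)
        note t = elim[THEN conjunct1]
        show ?case
        proof (rule upper)
          fix x assume x: "1 * t < x" "x < l * t"
          have "t * w t / l \<le> t * w t" using l lt[OF t] wpos[of t] by (simp add: field_simps) (simp add: mult_le_cancel_right1)
          also have "\<dots> \<le> x * w x" using x m[of t x] lt[OF t] wpos[of t] by (intro mult_mono) auto
          finally show "t * w t / l \<le> g x" using lt[OF t] x by (simp add: g_eq)
        qed (use l lt[OF t] elim in auto)
      qed
      moreover have "\<forall>\<^sub>F t in at_top. (1 / l) * (J (1 / l) 1 t / r t / \<Lambda> (1 / l) 1) \<le> t\<^sup>2 * w t / r t"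
        using large
      proof eventually_elim
        case (elim t)
        note t = elim[THEN conjunct1]
        show ?case
        proof (rule lower)
          fix x assume x: "1 / l * t < x" "x < 1 * t"
          note xt = xt[OF t x(1)]
          have "x * w x \<le> t * w t" using x m[of x t] lt[OF t] wpos[of x] xt t1 by (intro mult_mono) auto
          also have "t * w t \<le> l * (t * w t)" using mult_right_mono[of 1 l "t * w t"] l lt[OF t] wpos[of t] by simp
          finally show "g x \<le> l * (t * w t)" using xt by (simp add: g_eq)
        qed (use l lt[OF t] elim in auto)
      qed
      ultimately show ?thesis using l by (intro conjI exI[of _ 1] exI[of _ l] exI[of _ "1 / l"]) auto
    next
      case False
      hence "antimono_on {t0..} w" using mono by auto
      hence m: "w y \<le> w x" if "t1 \<le> x" "x \<le> y" for x y using that t1 by (auto simp: monotone_on_def)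
      have "\<forall>\<^sub>F t in at_top. t\<^sup>2 * w t / r t \<le> l * (J (1 / l) 1 t / r t / \<Lambda> (1 / l) 1)"
        using large
      proof eventually_elim
        case (elim t)
        note t = elim[THEN conjunct1]
        show ?case
        proof (rule upper)
          fix x assume x: "1 / l * t < x" "x < 1 * t"
          note xt = xt[OF t x(1)]
          have "(1 / l * t) * w t \<le> x * w x" using x m[of x t] lt[OF t] wpos[of t] xt t1 by (intro mult_mono) auto
          thus "t * w t / l \<le> g x" using xt by (simp add: g_eq)
        qed (use l lt[OF t] elim in auto)
      qed
      moreover have "\<forall>\<^sub>F t in at_top. (1 / l) * (J 1 l t / r t / \<Lambda> 1 l) \<le> t\<^sup>2 * w t / r t"
        using large
      proof eventually_elim
        case (elim t)
        note t = elim[THEN conjunct1]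
        show ?case
        proof (rule lower)
          fix x assume x: "1 * t < x" "x < l * t"
          have "x * w x \<le> (l * t) * w t" using x m[of t x] lt[OF t] wpos[of x] l by (intro mult_mono) auto
          thus "g x \<le> l * (t * w t)" using x lt[OF t] by (simp add: g_eq mult_ac)
        qed (use l lt[OF t] elim in auto)
      qed
      ultimately show ?thesis using l by (intro conjI exI[of _ 1] exI[of _ l] exI[of _ "1 / l"]) auto
    qed
  qed
  show ?thesis
  proof (rule order_tendstoI)
    fix c assume c: "c < A"
    have "((\<lambda>l. (1 / l) * A) \<longlongrightarrow> (1 / 1) * A) (at_right (1::real))" by (intro tendsto_intros) auto
    hence "\<forall>\<^sub>F l in at_right 1. (1 / l) * A > c" using c by (intro order_tendstoD) auto
    hence "\<forall>\<^sub>F l in at_right 1. l > 1 \<and> (1 / l) * A > c"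
      using eventually_at_right_less[of 1] by eventually_elim auto
    then obtain l where l: "l > 1" "(1 / l) * A > c"
      using eventually_happens[of _ "at_right (1::real)"] by auto
    obtain a b where ab: "0 \<le> a" "a < b" and ev: "\<forall>\<^sub>F t in at_top. (1 / l) * (J a b t / r t / \<Lambda> a b) \<le> t\<^sup>2 * w t / r t"
      using bounds[OF l(1)] by blast
    have "\<forall>\<^sub>F t in at_top. (1 / l) * (J a b t / r t / \<Lambda> a b) > c"
      by (rule order_tendstoD(1)[OF limJ'[OF ab] l(2)])
    with ev show "\<forall>\<^sub>F t in at_top. c < t\<^sup>2 * w t / r t" by eventually_elim simp
  next
    fix c assume c: "A < c"
    have "((\<lambda>l. l * A) \<longlongrightarrow> 1 * A) (at_right (1::real))" by (intro tendsto_intros)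
    hence "\<forall>\<^sub>F l in at_right 1. l * A < c" using c by (intro order_tendstoD) auto
    hence "\<forall>\<^sub>F l in at_right 1. l > 1 \<and> l * A < c"
      using eventually_at_right_less[of 1] by eventually_elim auto
    then obtain l where l: "l > 1" "l * A < c"
      using eventually_happens[of _ "at_right (1::real)"] by auto
    obtain a b where ab: "0 \<le> a" "a < b" and ev: "\<forall>\<^sub>F t in at_top. t\<^sup>2 * w t / r t \<le> l * (J a b t / r t / \<Lambda> a b)"
      using bounds[OF l(1)] by blast
    have "\<forall>\<^sub>F t in at_top. l * (J a b t / r t / \<Lambda> a b) < c"
      by (rule order_tendstoD(2)[OF limJ'[OF ab] l(2)])
    with ev show "\<forall>\<^sub>F t in at_top. t\<^sup>2 * w t / r t < c" by eventually_elim simp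
  qed
qed

section \<open>An Abelian theorem for slowly varying tails\<close>

text \<open>
  The monotonicity of \<open>T\<close> is what makes slow variation quantitative: it controls \<open>L\<close> uniformly
  between \<open>t\<close> and \<open>2 t\<close>.
\<close>

locale slowly_varying_tail =
  fixes T L :: "real \<Rightarrow> real"
  assumes T_antimono: "\<And>x y. x \<le> y \<Longrightarrow> T y \<le> T x"
    and T_nonneg: "\<And>x. 0 \<le> T x" and T_le_1: "\<And>x. T x \<le> 1"
    and L_eq: "\<And>t. 0 < t \<Longrightarrow> L t = t\<^sup>2 * T t"
    and L_slow: "\<And>c. c > 0 \<Longrightarrow> ((\<lambda>t. L (c * t) / L t) \<longlongrightarrow> 1) at_top"
begin

lemma L_eventually_pos: "\<forall>\<^sub>F t in at_top. L t > 0"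
proof -
  have "\<forall>\<^sub>F t in at_top. L (1 * t) / L t > 0"
    by (rule order_tendstoD[OF L_slow]) auto
  thus ?thesis using eventually_gt_at_top[of 0]
  proof eventually_elim
    case (elim t)
    hence "L t \<noteq> 0" by auto
    thus ?case using elim T_nonneg[of t] by (simp add: L_eq less_le)
  qed
qed

text \<open>
  Eventually a doubling or halving of the argument multiplies \<open>L\<close> by at most \<open>\<surd>2\<close>, so moving from \<open>t\<close>
  to \<open>y t\<close> in dyadic steps costs a factor of order \<open>\<surd>y\<close> or \<open>1 / \<surd>y\<close>. The bound
  for small \<open>y\<close> also covers \<open>y t < t0\<close>, where slow variation says nothing: the halving
  stops as soon as the argument falls below \<open>2 t0\<close>, and there \<open>T \<le> 1\<close> is enough.
\<close>

lemma Potter_bound: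
  obtains C t0 where "C > 0" "t0 > 0" "\<And>t. t \<ge> t0 \<Longrightarrow> L t > 0"
    "\<And>t y. t \<ge> t0 \<Longrightarrow> 1 \<le> y \<Longrightarrow> L (y * t) \<le> C * sqrt y * L t"
    "\<And>t y. t \<ge> t0 \<Longrightarrow> 0 < y \<Longrightarrow> y \<le> 1 \<Longrightarrow> L (y * t) \<le> C / sqrt y * L t"
proof -
  have lim2: "((\<lambda>t. L (2 * t) / L t) \<longlongrightarrow> 1) at_top" by (rule L_slow) simp
  have s2: "sqrt 2 > 1" "1 / sqrt 2 < 1" by auto
  have "\<forall>\<^sub>F t in at_top. L t > 0 \<and> L (2 * t) / L t < sqrt 2 \<and> L (2 * t) / L t > 1 / sqrt 2"
    using L_eventually_pos order_tendstoD(2)[OF lim2 s2(1)] order_tendstoD(1)[OF lim2 s2(2)]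
    by eventually_elim auto
  then obtain t00 where t00: "\<And>t. t \<ge> t00 \<Longrightarrow> L t > 0 \<and> L (2 * t) / L t < sqrt 2 \<and> L (2 * t) / L t > 1 / sqrt 2"
    by (auto simp: eventually_at_top_linorder)
  define t0 where "t0 = 2 * max 1 t00"
  have t0: "t0 > 0" "t0 / 2 \<ge> t00" "t0 \<ge> t00" unfolding t0_def by auto
  have Lpos: "L t > 0" if "t \<ge> t0" for t using t00[of t] t0 that by auto
  have up: "L (2 * t) \<le> sqrt 2 * L t" if "t \<ge> t0" for t
    using t00[of t] Lpos[OF that] t0 that by (simp add: divide_less_eq)
  have down: "L (t / 2) \<le> sqrt 2 * L t" if "t \<ge> t0" for t
  proof -
    have "L (t / 2) > 0" "1 / sqrt 2 < L t / L (t / 2)" using t00[of "t / 2"] t0 that by auto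
    thus ?thesis by (simp add: field_simps)
  qed
  have T0: "T (2 * t0) > 0"
    using Lpos[of "2 * t0"] t0 T_nonneg[of "2 * t0"] by (auto simp: L_eq zero_less_mult_iff)
  \<comment> \<open>The first term serves the dyadic steps, the second the starting points \<open>t < 2 t0\<close>, for which \<open>T t \<ge> T (2 t0)\<close>.\<close>
  define C where "C = 4 * sqrt 2 + 4 / T (2 * t0)"
  have "4 / T (2 * t0) > 0" using T0 by simp
  hence C: "C > 0" "C \<ge> 4 * sqrt 2" "C \<ge> 4 / T (2 * t0)" "C \<ge> 4"
    unfolding C_def using s2(1) by linarith+
  have big: "L (y * t) \<le> C * sqrt y * L t" if "t \<ge> t0" "1 \<le> y" "y \<le> 2 ^ n" for t y n
    using that
  proof (induction n arbitrary: y t)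
    case (0 y t)
    hence "y = 1" by simp
    thus ?case using C(4) s2 Lpos[of t] 0 by simp
  next
    case (Suc n y t)
    show ?case
    proof (cases "y \<le> 2")
      case True
      have "L (y * t) = y\<^sup>2 * t\<^sup>2 * T (y * t)"
        using Suc.prems t0 by (simp add: L_eq power_mult_distrib)
      also have "\<dots> \<le> 2\<^sup>2 * t\<^sup>2 * T t"
      proof (intro mult_mono power_mono T_antimono)
        show "t \<le> y * t" using Suc.prems t0 mult_right_mono[of 1 y t] by simp
      qed (use Suc.prems True T_nonneg t0 in auto)
      also have "\<dots> = 4 * L t" using Suc.prems t0 by (simp add: L_eq)
      also have "\<dots> \<le> C * L t" using Lpos[OF Suc.prems(1)] C by simp
      also have "\<dots> \<le> C * sqrt y * L t"
        using Lpos[OF Suc.prems(1)] C Suc.prems by simp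
      finally show ?thesis .
    next
      case False
      have "L (y * t) = L ((y / 2) * (2 * t))" by simp
      also have "\<dots> \<le> C * sqrt (y / 2) * L (2 * t)"
        by (rule Suc.IH) (use Suc.prems False t0 in auto)
      also have "\<dots> \<le> C * sqrt (y / 2) * (sqrt 2 * L t)"
        using C Suc.prems by (intro mult_left_mono up) auto
      also have "\<dots> = C * sqrt y * L t" by (simp add: real_sqrt_divide)
      finally show ?thesis .
    qed
  qed
  have small: "L (y * t) \<le> C / sqrt y * L t" if "t \<ge> t0" "0 < y" "y \<le> 1" "1 \<le> y * 2 ^ n" for t y n
    using that
  proof (induction n arbitrary: y t)
    case (0 y t)
    hence "y = 1" by simp
    thus ?case using C(4) s2 Lpos[of t] 0 by simp
  next
    case (Suc n y t)
    have t: "t > 0" using Suc.prems t0 by simp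
    have Lt: "L t > 0" using Lpos Suc.prems by simp
    have grow: "C * L t \<le> C / sqrt y * L t"
    proof -
      have "C * L t * sqrt y \<le> C * L t * 1" using Lt C Suc.prems by (intro mult_left_mono) auto
      thus ?thesis using Suc.prems by (simp add: field_simps)
    qed
    show ?case
    proof (cases "1 / 2 \<le> y")
      case True
      have "L (y * t) = y\<^sup>2 * t\<^sup>2 * T (y * t)"
        using Suc.prems t by (simp add: L_eq power_mult_distrib)
      also have "\<dots> \<le> 1\<^sup>2 * t\<^sup>2 * T (t / 2)"
      proof (intro mult_mono power_mono T_antimono)
        show "t / 2 \<le> y * t" using True t mult_right_mono[of "1 / 2" y t] by simp
      qed (use Suc.prems True T_nonneg t in auto)
      also have "\<dots> = 4 * L (t / 2)" using t by (simp add: L_eq power_divide)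
      also have "\<dots> \<le> 4 * (sqrt 2 * L t)" using down[OF Suc.prems(1)] by simp
      also have "\<dots> \<le> C * L t" using Lt C(2) by simp
      finally show ?thesis using grow by simp
    next
      case False
      show ?thesis
      proof (cases "t \<ge> 2 * t0")
        case True
        have "L (y * t) = L ((2 * y) * (t / 2))" by simp
        also have "\<dots> \<le> C / sqrt (2 * y) * L (t / 2)"
          by (rule Suc.IH) (use Suc.prems False True in auto)
        also have "\<dots> \<le> C / sqrt (2 * y) * (sqrt 2 * L t)"
          using C Suc.prems by (intro mult_left_mono down) auto
        also have "\<dots> = C / sqrt y * L t" by (simp add: real_sqrt_mult)
        finally show ?thesis .
      next
        case False
        have "L (y * t) = y\<^sup>2 * t\<^sup>2 * T (y * t)"
          using Suc.prems t by (simp add: L_eq power_mult_distrib)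
        also have "\<dots> \<le> 1\<^sup>2 * t\<^sup>2 * 1"
          by (intro mult_mono power_mono T_le_1) (use Suc.prems T_nonneg t in auto)
        also have "\<dots> \<le> t\<^sup>2 * (C * T (2 * t0))"
          using C(3) T0 t mult_left_mono[of 1 "C * T (2 * t0)" "t\<^sup>2"] by (simp add: field_simps)
        also have "\<dots> \<le> t\<^sup>2 * (C * T t)"
          using False C by (intro mult_left_mono T_antimono) auto
        also have "\<dots> = C * L t" using t by (simp add: L_eq)
        finally show ?thesis using grow by simp
      qed
    qed
  qed
  show ?thesis
  proof (rule that[OF C(1) t0(1) Lpos])
    show "L (y * t) \<le> C * sqrt y * L t" if "t \<ge> t0" "1 \<le> y" for t y
    proof -
      obtain n where "y < 2 ^ n" using real_arch_pow[of 2 y] by auto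
      thus ?thesis using big[OF that, of n] by simp
    qed
    show "L (y * t) \<le> C / sqrt y * L t" if "t \<ge> t0" "0 < y" "y \<le> 1" for t y
    proof -
      obtain n where "1 / y < 2 ^ n" using real_arch_pow[of 2 "1 / y"] by auto
      thus ?thesis using small[OF that, of n] that by (simp add: field_simps)
    qed
  qed
qed

text \<open>
  The Potter bound from \<open>t\<close> down to the fixed point \<open>t0\<close> says that \<open>L(t)\<close> decays no faster
  than \<open>t powr (- 1 / 2)\<close>.
\<close>

lemma times_L_at_top: "filterlim (\<lambda>t. t * L t) at_top at_top"
proof -
  obtain C t0 where C: "C > 0" "t0 > 0" and Lpos: "\<And>t. t \<ge> t0 \<Longrightarrow> L t > 0"
    and small: "\<And>t y. t \<ge> t0 \<Longrightarrow> 0 < y \<Longrightarrow> y \<le> 1 \<Longrightarrow> L (y * t) \<le> C / sqrt y * L t"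
    by (rule Potter_bound) (rule that)
  define k where "k = L t0 * sqrt t0 / C"
  have k: "k > 0" unfolding k_def using C Lpos[of t0] by simp
  have "filterlim (\<lambda>t. k * sqrt t) at_top at_top"
    by (rule filterlim_tendsto_pos_mult_at_top[OF tendsto_const k sqrt_at_top])
  thus ?thesis
  proof (rule filterlim_at_top_mono)
    show "\<forall>\<^sub>F t in at_top. k * sqrt t \<le> t * L t"
      using eventually_ge_at_top[of t0]
    proof eventually_elim
      case (elim t)
      have t: "t > 0" using elim C by simp
      have "L t0 \<le> C / sqrt (t0 / t) * L t"
        using small[of t "t0 / t"] elim t C by simp
      hence "L t0 * sqrt t0 / C \<le> sqrt t * L t"
        using C t by (simp add: real_sqrt_divide field_simps)
      hence "k * sqrt t \<le> sqrt t * L t * sqrt t"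
        unfolding k_def using t by (intro mult_right_mono) auto
      also have "\<dots> = t * L t" using t by (simp add: mult_ac)
      finally show ?case .
    qed
  qed
qed

end

text \<open>
  The distribution function of the sum of two independent standard exponential variables. It
  arises here as \<open>\<integral>\<^sub>0\<^sup>y z exp (- z) dz\<close>.
\<close>

definition erlang2 :: "real \<Rightarrow> real" where
  "erlang2 y = 1 - (1 + y) * exp (- y)"

lemma erlang2_nonneg: "0 \<le> erlang2 y"
proof -
  have "(1 + y) * exp (- y) \<le> exp y * exp (- y)" by (intro mult_right_mono exp_ge_add_one_self) auto
  thus ?thesis by (simp add: erlang2_def flip: exp_add)
qed

lemma erlang2_le_1: "0 \<le> y \<Longrightarrow> erlang2 y \<le> 1"
  by (simp add: erlang2_def)

lemma erlang2_le_square: "0 \<le> y \<Longrightarrow> erlang2 y \<le> y\<^sup>2"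
  using mult_left_mono[OF exp_ge_add_one_self[of "- y"], of "1 + y"]
  by (simp add: erlang2_def algebra_simps power2_eq_square)

lemma borel_measurable_erlang2[measurable]: "erlang2 \<in> borel_measurable borel"
  unfolding erlang2_def by measurable

lemma has_bochner_integral_erlang2:
  "has_bochner_integral lborel (\<lambda>y. erlang2 y / y\<^sup>2 * indicator {0<..} y) 1"
proof -
  let ?F = "\<lambda>y::real. - (1 - exp (- y)) / y"
  have e: "einterval 0 \<infinity> = {0::real<..}" by (auto simp: einterval_def zero_ereal_def)
  have d: "DERIV ?F x :> erlang2 x / x\<^sup>2" if "0 < ereal x" for x
    using that by (auto intro!: derivative_eq_intros simp: erlang2_def field_simps power2_eq_square)
  have c: "isCont (\<lambda>y. erlang2 y / y\<^sup>2) x" if "0 < ereal x" for x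
    using that unfolding erlang2_def by (auto intro!: continuous_intros)
  have l0: "((?F \<circ> real_of_ereal) \<longlongrightarrow> -1) (at_right 0)"
  proof -
    have "(?F \<longlongrightarrow> -1) (at_right 0)" by real_asymp
    thus ?thesis unfolding zero_ereal_def by (simp add: ereal_tendsto_simps)
  qed
  have l1: "((?F \<circ> real_of_ereal) \<longlongrightarrow> 0) (at_left \<infinity>)"
  proof -
    have "(?F \<longlongrightarrow> 0) at_top" by real_asymp
    thus ?thesis by (simp add: ereal_tendsto_simps)
  qed
  have nn: "AE x in lborel. 0 < ereal x \<longrightarrow> ereal x < \<infinity> \<longrightarrow> 0 \<le> erlang2 x / x\<^sup>2"
    by (simp add: erlang2_nonneg)
  from interval_integral_FTC_nonneg[OF _ d c nn l0 l1]
  have "set_integrable lborel {0<..} (\<lambda>y. erlang2 y / y\<^sup>2)" "(LBINT y=0..\<infinity>. erlang2 y / y\<^sup>2) = 1"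
    unfolding e by auto
  thus ?thesis
    by (simp add: has_bochner_integral_iff interval_lebesgue_integral_def e set_integrable_def
        set_lebesgue_integral_def mult.commute)
qed

text \<open>
  Up to a constant, this dominates \<open>max (\<surd>y) (1 / \<surd>y) erlang2 y / y\<^sup>2\<close>, the Potter bound
  times the kernel.
\<close>

lemma integrable_Potter_majorant:
  "integrable lborel (\<lambda>y::real. indicator {0<..<1} y / sqrt y + indicator {1<..} y / (y * sqrt y))"
proof (rule Bochner_Integration.integrable_add)
  have e: "einterval 0 1 = {0<..<1::real}" by (auto simp: einterval_def zero_ereal_def one_ereal_def)
  have "set_integrable lborel (einterval 0 1) (\<lambda>y::real. 1 / sqrt y)"
  proof (rule interval_integral_FTC_nonneg(1))
    show "DERIV (\<lambda>x. 2 * sqrt x) x :> 1 / sqrt x" if "0 < ereal x" for x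
      using that by (auto intro!: derivative_eq_intros simp: field_simps)
    show "isCont (\<lambda>x. 1 / sqrt x) x" if "0 < ereal x" for x
      using that by (auto intro!: continuous_intros)
    show "(((\<lambda>x. 2 * sqrt x) \<circ> real_of_ereal) \<longlongrightarrow> 0) (at_right 0)"
    proof -
      have "((\<lambda>x. 2 * sqrt x) \<longlongrightarrow> 0) (at_right 0)" by real_asymp
      thus ?thesis unfolding zero_ereal_def by (simp add: ereal_tendsto_simps)
    qed
    show "(((\<lambda>x. 2 * sqrt x) \<circ> real_of_ereal) \<longlongrightarrow> 2) (at_left 1)"
    proof -
      have "((\<lambda>x. 2 * sqrt x) \<longlongrightarrow> 2 * sqrt 1) (at_left 1)" by (intro tendsto_intros)
      thus ?thesis unfolding one_ereal_def by (simp add: ereal_tendsto_simps)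
    qed
  qed auto
  thus "integrable lborel (\<lambda>y::real. indicator {0<..<1} y / sqrt y)"
    unfolding e set_integrable_def by simp
  have e: "einterval 1 \<infinity> = {1::real<..}" by (auto simp: einterval_def one_ereal_def)
  have "set_integrable lborel (einterval 1 \<infinity>) (\<lambda>y::real. 1 / (y * sqrt y))"
  proof (rule interval_integral_FTC_nonneg(1))
    show "DERIV (\<lambda>x. - 2 / sqrt x) x :> 1 / (x * sqrt x)" if "1 < ereal x" for x
      using that by (auto intro!: derivative_eq_intros simp: field_simps)
    show "isCont (\<lambda>x. 1 / (x * sqrt x)) x" if "1 < ereal x" for x
      using that by (auto intro!: continuous_intros)
    show "(((\<lambda>x. - 2 / sqrt x) \<circ> real_of_ereal) \<longlongrightarrow> - 2) (at_right 1)"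
    proof -
      have "((\<lambda>x. - 2 / sqrt x) \<longlongrightarrow> - 2 / sqrt 1) (at_right 1)" by (intro tendsto_intros) auto
      thus ?thesis unfolding one_ereal_def by (simp add: ereal_tendsto_simps)
    qed
    show "(((\<lambda>x. - 2 / sqrt x) \<circ> real_of_ereal) \<longlongrightarrow> 0) (at_left \<infinity>)"
    proof -
      have "((\<lambda>x. - 2 / sqrt x) \<longlongrightarrow> 0) at_top" by real_asymp
      thus ?thesis by (simp add: ereal_tendsto_simps)
    qed
  qed auto
  thus "integrable lborel (\<lambda>y::real. indicator {1<..} y / (y * sqrt y))"
    unfolding e set_integrable_def by simp
qed

text \<open>
  With \<open>T(x) = L(x) / x\<^sup>2\<close> and \<open>x = t y\<close> the quantity equals
  \<open>\<integral> L(t y) / L(t) (erlang2 y / y\<^sup>2) dy\<close>, where the first factor tends to \<open>1\<close> pointwise and the kernel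
  has integral \<open>1\<close>.
\<close>

lemma (in slowly_varying_tail) Abelian_erlang2:
  "((\<lambda>t. t * (LINT x|lborel. T x * erlang2 (x / t) * indicator {0..} x) / L t) \<longlongrightarrow> 1) at_top"
proof -
  obtain C t0 where C: "C > 0" "t0 > 0" and Lpos: "\<And>t. t \<ge> t0 \<Longrightarrow> L t > 0"
    and big: "\<And>t y. t \<ge> t0 \<Longrightarrow> 1 \<le> y \<Longrightarrow> L (y * t) \<le> C * sqrt y * L t"
    and small: "\<And>t y. t \<ge> t0 \<Longrightarrow> 0 < y \<Longrightarrow> y \<le> 1 \<Longrightarrow> L (y * t) \<le> C / sqrt y * L t"
    by (rule Potter_bound) (rule that)
  have [measurable]: "T \<in> borel_measurable borel"
  proof -
    have "mono (\<lambda>x. - T x)" by (intro monoI) (simp add: T_antimono)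
    hence "(\<lambda>x. - (- T x)) \<in> borel_measurable borel"
      by (intro borel_measurable_uminus borel_measurable_mono)
    thus ?thesis by simp
  qed
  define k where "k t y = (t * y)\<^sup>2 * T (t * y) / L t * (erlang2 y / y\<^sup>2 * indicator {0<..} y)" for t y
  have k_eq: "k t y = L (y * t) / L t * (erlang2 y / y\<^sup>2 * indicator {0<..} y)" if "t > 0" for t y
    using that by (cases "y > 0") (simp_all add: k_def L_eq mult.commute)
  have lim: "((\<lambda>t. LINT y|lborel. k t y) \<longlongrightarrow> (LINT y|lborel. erlang2 y / y\<^sup>2 * indicator {0<..} y)) at_top"
  proof (rule integral_dominated_convergence_at_top)
    show "integrable lborel (\<lambda>y. C * (indicator {0<..<1} y / sqrt y + indicator {1<..} y / (y * sqrt y)))"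
      by (intro integrable_mult_right integrable_Potter_majorant)
    show "\<forall>\<^sub>F t in at_top. AE y in lborel. norm (k t y) \<le> C * (indicator {0<..<1} y / sqrt y + indicator {1<..} y / (y * sqrt y))"
      using eventually_ge_at_top[of t0]
    proof eventually_elim
      case (elim t)
      have t: "t > 0" using elim C by simp
      note L = Lpos[OF elim]
      have "AE y in lborel. y \<noteq> (1::real)" by (rule AE_lborel_singleton)
      thus ?case
      proof eventually_elim
        case (elim y)
        show ?case
        proof (cases "y > 0")
          case True
          have Lyt: "L (y * t) \<ge> 0" using True t T_nonneg by (simp add: L_eq)
          have "norm (k t y) = L (y * t) / L t * (erlang2 y / y\<^sup>2)"
            using True Lyt L erlang2_nonneg[of y] by (simp add: k_eq[OF t])
          also have "\<dots> \<le> C * (indicator {0<..<1} y / sqrt y + indicator {1<..} y / (y * sqrt y))"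
          proof (cases "y < 1")
            case y: True
            have "L (y * t) / L t \<le> C / sqrt y" using small[OF \<open>t0 \<le> t\<close> True] y L by (simp add: field_simps)
            moreover have "erlang2 y / y\<^sup>2 \<le> 1" using erlang2_le_square[of y] True by simp
            ultimately have "L (y * t) / L t * (erlang2 y / y\<^sup>2) \<le> C / sqrt y * 1"
              using L Lyt erlang2_nonneg[of y] C True by (intro mult_mono) auto
            thus ?thesis using y True by simp
          next
            case False
            hence y: "y > 1" using elim by simp
            have "L (y * t) / L t \<le> C * sqrt y" using big[OF \<open>t0 \<le> t\<close>, of y] y L by (simp add: field_simps)
            moreover have "erlang2 y / y\<^sup>2 \<le> 1 / y\<^sup>2" using erlang2_le_1[of y] True by (simp add: divide_right_mono)
            ultimately have "L (y * t) / L t * (erlang2 y / y\<^sup>2) \<le> C * sqrt y * (1 / y\<^sup>2)"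
              using L Lyt erlang2_nonneg[of y] C True by (intro mult_mono) auto
            also have "\<dots> = C * (1 / (y * sqrt y))"
              using True by (simp add: field_simps power2_eq_square)
            finally show ?thesis using y by simp
          qed
          finally show ?thesis .
        qed (simp add: k_def)
      qed
    qed
    show "AE y in lborel. ((\<lambda>t. k t y) \<longlongrightarrow> erlang2 y / y\<^sup>2 * indicator {0<..} y) at_top"
    proof (rule AE_I2)
      fix y :: real
      show "((\<lambda>t. k t y) \<longlongrightarrow> erlang2 y / y\<^sup>2 * indicator {0<..} y) at_top"
      proof (cases "y > 0")
        case True
        have "((\<lambda>t. L (y * t) / L t * (erlang2 y / y\<^sup>2 * indicator {0<..} y)) \<longlongrightarrow> 1 * (erlang2 y / y\<^sup>2 * indicator {0<..} y)) at_top"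
          by (intro tendsto_mult L_slow True tendsto_const)
        moreover have "\<forall>\<^sub>F t in at_top. L (y * t) / L t * (erlang2 y / y\<^sup>2 * indicator {0<..} y) = k t y"
          using eventually_gt_at_top[of 0] by eventually_elim (simp add: k_eq)
        ultimately show ?thesis by (simp add: Lim_transform_eventually)
      qed (simp add: k_def)
    qed
  qed (auto simp: k_def)
  have "\<forall>\<^sub>F t in at_top. (LINT y|lborel. k t y) = t * (LINT x|lborel. T x * erlang2 (x / t) * indicator {0..} x) / L t"
    using eventually_ge_at_top[of t0]
  proof eventually_elim
    case (elim t)
    have t: "t > 0" using elim C by simp
    have scale: "(LINT x|lborel. T x * erlang2 (x / t) * indicator {0..} x) =
        t * (LINT y|lborel. T (t * y) * erlang2 (t * y / t) * indicator {0..} (t * y))"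
      using lborel_integral_real_affine[of t "\<lambda>x. T x * erlang2 (x / t) * indicator {0..} x" 0] t by simp
    have "t * (LINT x|lborel. T x * erlang2 (x / t) * indicator {0..} x) / L t =
        (LINT y|lborel. t * (t * (T (t * y) * erlang2 (t * y / t) * indicator {0..} (t * y))) / L t)"
      unfolding scale by simp
    also have "\<dots> = (LINT y|lborel. k t y)"
    proof (rule Bochner_Integration.integral_cong[OF refl])
      fix y :: real
      show "t * (t * (T (t * y) * erlang2 (t * y / t) * indicator {0..} (t * y))) / L t = k t y"
      proof (cases "y > 0")
        case True
        thus ?thesis using t by (simp add: k_def power2_eq_square)
      next
        case False
        hence "erlang2 y * indicator {0..} (t * y) = 0"
          using t by (cases "y = 0") (simp_all add: erlang2_def zero_le_mult_iff indicator_def)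
        thus ?thesis using False t by (simp add: k_def)
      qed
    qed
    finally show ?case by (rule sym)
  qed
  with lim show ?thesis
    using has_bochner_integral_erlang2 by (simp add: has_bochner_integral_iff Lim_transform_eventually)
qed

section \<open>Laplace transforms of a distribution and its tail\<close>

context real_distribution
begin

lemma integrable_exp_minus:
  assumes nonneg: "AE x in M. 0 \<le> x" and s: "s > 0"
  shows "integrable M (\<lambda>x. exp (- (s * x)))"
  by (rule integrable_const_bound[of _ 1]) (use nonneg s in \<open>auto elim!: eventually_mono\<close>)

lemma integrable_mult_exp_minus:
  assumes nonneg: "AE x in M. 0 \<le> x" and int: "integrable M (\<lambda>x. x)" and s: "s > 0"
  shows "integrable M (\<lambda>x. x * exp (- (s * x)))"
  by (rule Bochner_Integration.integrable_bound[OF int])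
     (use nonneg s in \<open>auto elim!: eventually_mono simp: abs_mult mult_left_le\<close>)

text \<open>
  Both sides are \<open>E (H X)\<close> for the antiderivative \<open>H\<close> of \<open>y \<mapsto> erlang2 (s y)\<close> that vanishes
  at \<open>0\<close>: the left one by Fubini's theorem, the right one by computing \<open>H\<close>.
\<close>

lemma expectation_erlang2_tail:
  assumes nonneg: "AE x in M. 0 \<le> x" and int: "integrable M (\<lambda>x. x)" and s: "s > 0"
  shows "(LINT y|lborel. (1 - cdf M y) * erlang2 (s * y) * indicator {0..} y) =
           (LINT x|M. x) - 2 * ((1 - (LINT x|M. exp (- (s * x)))) / s) + (LINT x|M. x * exp (- (s * x)))"
proof -
  define H where "H x = x - 2 * ((1 - exp (- (s * x))) / s) + x * exp (- (s * x))" for x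
  interpret P: pair_sigma_finite M lborel ..
  note i1 = integrable_exp_minus[OF nonneg s]
  note i2 = integrable_mult_exp_minus[OF nonneg int s]
  have intH: "integrable M H"
    unfolding H_def by (intro Bochner_Integration.integrable_add Bochner_Integration.integrable_diff
      integrable_mult_right integrable_divide i1 i2 int integrable_const)
  have H_eq: "(\<integral>\<^sup>+y. ennreal (erlang2 (s * y)) * indicator {0..x} y \<partial>lborel) = ennreal (H x)" if "x \<ge> 0" for x
  proof -
    have "(\<integral>\<^sup>+y. ennreal (erlang2 (s * y)) * indicator {0..x} y \<partial>lborel) = ennreal (H x - H 0)"
    proof (rule nn_integral_FTC_Icc)
      show "(H has_real_derivative erlang2 (s * y)) (at y)" for y
        unfolding H_def erlang2_def using s by (auto intro!: derivative_eq_intros simp: field_simps)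
    qed (use that erlang2_nonneg in auto)
    thus ?thesis by (simp add: H_def)
  qed
  have H0: "H x \<ge> 0" if "x \<ge> 0" for x
  proof -
    have "H 0 \<le> H x"
    proof (rule DERIV_nonneg_imp_nondecreasing[OF that])
      fix y
      have "(H has_real_derivative erlang2 (s * y)) (at y)"
        unfolding H_def erlang2_def using s by (auto intro!: derivative_eq_intros simp: field_simps)
      thus "\<exists>d. (H has_real_derivative d) (at y) \<and> 0 \<le> d" using erlang2_nonneg by blast
    qed
    thus ?thesis by (simp add: H_def)
  qed
  have tail: "1 - cdf M y = prob {y<..}" for y
  proof -
    have "{y<..} = space M - {..y}" by auto
    hence "prob {y<..} = prob (space M - {..y})" by simp
    also have "\<dots> = 1 - prob {..y}" by (rule prob_compl) simp
    finally show ?thesis by (simp add: cdf_def)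
  qed
  have "(\<integral>\<^sup>+y. ennreal ((1 - cdf M y) * erlang2 (s * y) * indicator {0..} y) \<partial>lborel) =
      (\<integral>\<^sup>+y. (\<integral>\<^sup>+x. ennreal (erlang2 (s * y)) * (if 0 \<le> y \<and> y < x then 1 else 0) \<partial>M) \<partial>lborel)"
  proof (rule nn_integral_cong)
    fix y :: real
    have "(\<integral>\<^sup>+x. ennreal (erlang2 (s * y)) * (if 0 \<le> y \<and> y < x then 1 else 0) \<partial>M) =
       ennreal (erlang2 (s * y)) * (\<integral>\<^sup>+x. indicator {0..} y * indicator {y<..} x \<partial>M)"
      by (subst nn_integral_cmult[symmetric]) (auto intro!: nn_integral_cong split: split_indicator)
    also have "(\<integral>\<^sup>+x. indicator {0..} y * indicator {y<..} x \<partial>M) = indicator {0..} y * ennreal (1 - cdf M y)"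
      by (subst nn_integral_cmult) (auto simp: tail emeasure_eq_measure)
    finally show "ennreal ((1 - cdf M y) * erlang2 (s * y) * indicator {0..} y) =
        (\<integral>\<^sup>+x. ennreal (erlang2 (s * y)) * (if 0 \<le> y \<and> y < x then 1 else 0) \<partial>M)"
      by (auto simp: ennreal_mult' erlang2_nonneg mult_ac tail split: split_indicator)
  qed
  also have "\<dots> = (\<integral>\<^sup>+x. (\<integral>\<^sup>+y. ennreal (erlang2 (s * y)) * (if 0 \<le> y \<and> y < x then 1 else 0) \<partial>lborel) \<partial>M)"
    by (rule P.Fubini') measurable
  also have "\<dots> = (\<integral>\<^sup>+x. ennreal (H x) \<partial>M)"
  proof (rule nn_integral_cong_AE)
    show "AE x in M. (\<integral>\<^sup>+y. ennreal (erlang2 (s * y)) * (if 0 \<le> y \<and> y < x then 1 else 0) \<partial>lborel) = ennreal (H x)"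
      using nonneg
    proof eventually_elim
      case (elim x)
      have "AE y in lborel. y \<noteq> x" by (rule AE_lborel_singleton)
      hence "(\<integral>\<^sup>+y. ennreal (erlang2 (s * y)) * (if 0 \<le> y \<and> y < x then 1 else 0) \<partial>lborel) =
         (\<integral>\<^sup>+y. ennreal (erlang2 (s * y)) * indicator {0..x} y \<partial>lborel)"
        by (intro nn_integral_cong_AE) (auto elim!: eventually_mono split: split_indicator)
      thus ?case using H_eq[OF elim] by simp
    qed
  qed
  also have "\<dots> = ennreal (LINT x|M. H x)"
    by (rule nn_integral_eq_integral[OF intH]) (use nonneg H0 in \<open>auto elim!: eventually_mono\<close>)
  finally have nn: "(\<integral>\<^sup>+y. ennreal ((1 - cdf M y) * erlang2 (s * y) * indicator {0..} y) \<partial>lborel) = ennreal (LINT x|M. H x)" .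
  have [measurable]: "cdf M \<in> borel_measurable borel"
    by (intro borel_measurable_mono monoI cdf_nondecreasing)
  have "has_bochner_integral lborel (\<lambda>y. (1 - cdf M y) * erlang2 (s * y) * indicator {0..} y) (LINT x|M. H x)"
  proof (rule has_bochner_integral_nn_integral)
    show "AE y in lborel. 0 \<le> (1 - cdf M y) * erlang2 (s * y) * indicator {0..} y"
      by (intro AE_I2 mult_nonneg_nonneg erlang2_nonneg) (simp_all add: tail)
    show "0 \<le> (LINT x|M. H x)"
      by (rule integral_nonneg_AE) (use nonneg H0 in \<open>auto elim!: eventually_mono\<close>)
  qed (use nn in simp_all)
  moreover have "(LINT x|M. H x) = (LINT x|M. x) - 2 * ((1 - (LINT x|M. exp (- (s * x)))) / s) + (LINT x|M. x * exp (- (s * x)))"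
    unfolding H_def using i1 i2 int by (simp add: prob_space[unfolded space_eq_univ])
  ultimately show ?thesis by (simp add: has_bochner_integral_iff)
qed

text \<open>
  This follows from \<open>1 - z \<le> exp (- z) \<le> 1 - z + z\<^sup>2\<close> for \<open>z = s x \<ge> 0\<close>.
\<close>

lemma Laplace_first_order:
  assumes nonneg: "AE x in M. 0 \<le> x" and int: "integrable M (\<lambda>x. x)" and int2: "integrable M (\<lambda>x. x\<^sup>2)" and s: "s > 0"
  shows "\<bar>(LINT x|M. x) - (1 - (LINT x|M. exp (- (s * x)))) / s\<bar> \<le> s * (LINT x|M. x\<^sup>2)"
proof -
  note i1 = integrable_exp_minus[OF nonneg s]
  have "(LINT x|M. x) - (1 - (LINT x|M. exp (- (s * x)))) / s = (LINT x|M. x - (1 - exp (- (s * x))) / s)"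
    using i1 int by (simp add: prob_space[unfolded space_eq_univ])
  moreover have "norm (LINT x|M. x - (1 - exp (- (s * x))) / s) \<le> (LINT x|M. s * x\<^sup>2)"
  proof (rule order_trans[OF integral_norm_bound integral_mono_AE])
    show "AE x in M. norm (x - (1 - exp (- (s * x))) / s) \<le> s * x\<^sup>2"
      using nonneg
    proof eventually_elim
      case (elim x)
      define z where "z = s * x"
      have z: "z \<ge> 0" using elim s by (simp add: z_def)
      have "1 - z \<le> exp (- z)" using exp_ge_add_one_self[of "- z"] by simp
      moreover have "exp (- z) \<le> 1 - z + z\<^sup>2"
      proof -
        have "exp (- z) \<le> 1 / (1 + z)"
          using exp_ge_add_one_self[of z] z by (simp add: exp_minus field_simps)
        also have "\<dots> \<le> 1 - z + z\<^sup>2" using z by (simp add: field_simps power2_eq_square)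
        finally show ?thesis .
      qed
      ultimately have "\<bar>z - (1 - exp (- z))\<bar> / s \<le> z\<^sup>2 / s" using s by (intro divide_right_mono) auto
      also have "z\<^sup>2 / s = s * x\<^sup>2" using s by (simp add: z_def power2_eq_square)
      also have "\<bar>z - (1 - exp (- z))\<bar> / s = \<bar>(z - (1 - exp (- z))) / s\<bar>" using s by simp
      also have "(z - (1 - exp (- z))) / s = x - (1 - exp (- (s * x))) / s"
        using s by (simp add: z_def diff_divide_distrib)
      finally show ?case by simp
    qed
  qed (use i1 int int2 in auto)
  ultimately show ?thesis by simp
qed

end

section \<open>The Laplace transform of the renewal density\<close>

lemma
  assumes "prob_space M" and sets[measurable_cong]: "sets M = sets borel"
  shows sets_conv_power: "sets (conv_power M n) = sets borel"
    and prob_space_conv_power: "prob_space (conv_power M n)"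
proof -
  interpret prob_space M by fact
  show s: "sets (conv_power M n) = sets borel" for n by (cases n) auto
  show "prob_space (conv_power M n)"
  proof (induction n)
    case 0
    show ?case by (auto intro!: prob_space_return)
  next
    case (Suc n)
    interpret N: prob_space "conv_power M n" by fact
    interpret P: pair_prob_space M "conv_power M n" ..
    note [measurable_cong] = s[of n]
    show ?case unfolding conv_power.simps convolution_def
      by (rule P.prob_space_distr) measurable
  qed
qed

lemma convolution_return_0:
  assumes M: "finite_measure M" and sets: "sets M = sets borel"
  shows "convolution M (return borel 0) = (M :: real measure)"
proof (rule measure_eqI)
  show "sets (convolution M (return borel 0)) = sets M" using sets by simp
  note [measurable_cong] = sets
  fix A assume "A \<in> sets (convolution M (return borel 0))"
  hence A[measurable]: "A \<in> sets borel" by simp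
  have r: "finite_measure (return borel (0::real))"
    by (intro prob_space.finite_measure prob_space_return) simp
  have "emeasure (convolution M (return borel 0)) A =
      (\<integral>\<^sup>+x. \<integral>\<^sup>+y. indicator A (x + y) \<partial>return borel 0 \<partial>M)"
    by (rule convolution_emeasure'[OF A M r]) (simp_all add: sets)
  also have "\<dots> = (\<integral>\<^sup>+x. indicator A x \<partial>M)"
    by (intro nn_integral_cong) (simp add: nn_integral_return)
  also have "\<dots> = emeasure M A" using A by (simp add: sets)
  finally show "emeasure (convolution M (return borel 0)) A = emeasure M A" .
qed

lemma conv_power_density:
  assumes M: "M = density lborel f" and f[measurable]: "f \<in> borel_measurable borel" and "prob_space M"
  shows "\<exists>g. g \<in> borel_measurable borel \<and> conv_power M (Suc n) = density lborel g"
proof (induction n)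
  case 0
  have "conv_power M (Suc 0) = M"
    unfolding conv_power.simps
    by (rule convolution_return_0) (use assms in \<open>auto simp: prob_space.finite_measure\<close>)
  thus ?case using M f by (intro exI[of _ f]) auto
next
  case (Suc n)
  then obtain g where g[measurable]: "g \<in> borel_measurable borel" and gd: "conv_power M (Suc n) = density lborel g" by blast
  have s: "sets M = sets borel" by (simp add: M)
  have "conv_power M (Suc (Suc n)) = convolution (density lborel f) (density lborel g)"
    unfolding conv_power.simps(2)[of M "Suc n"] gd by (simp add: M)
  also have "\<dots> = density lborel (\<lambda>x. \<integral>\<^sup>+y. f (x - y) * g y \<partial>lborel)"
    using prob_space_conv_power[OF assms(3) s, of "Suc n"] assms(3)
    by (intro convolution_density f g) (simp_all add: M gd prob_space.finite_measure del: conv_power.simps flip: gd)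
  finally show ?case by (intro exI[of _ "\<lambda>x. \<integral>\<^sup>+y. f (x - y) * g y \<partial>lborel"]) auto
qed

context real_distribution
begin

lemma AE_conv_power_nonneg:
  assumes nonneg: "AE x in M. 0 \<le> x"
  shows "AE x in conv_power M n. 0 \<le> x"
proof (induction n)
  case 0
  show ?case unfolding conv_power.simps by (subst AE_return) auto
next
  case (Suc n)
  have fin: "finite_measure M" "finite_measure (conv_power M n)" 
    by (auto intro!: prob_space.finite_measure prob_space_conv_power prob_space_axioms)
  note s = sets_conv_power[OF prob_space_axioms events_eq_borel]
  have "(\<integral>\<^sup>+z. indicator {..<0} z \<partial>conv_power M (Suc n)) =
      (\<integral>\<^sup>+x. \<integral>\<^sup>+y. indicator {..<0} (x + y) \<partial>conv_power M n \<partial>M)"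
    unfolding conv_power.simps by (rule nn_integral_convolution[OF fin s events_eq_borel]) simp
  also have "\<dots> = (\<integral>\<^sup>+x. 0 \<partial>M)"
  proof (rule nn_integral_cong_AE)
    show "AE x in M. (\<integral>\<^sup>+y. indicator {..<0} (x + y) \<partial>conv_power M n) = 0"
      using nonneg
    proof eventually_elim
      case (elim x)
      have "(\<integral>\<^sup>+y. indicator {..<0} (x + y) \<partial>conv_power M n) = (\<integral>\<^sup>+y. 0 \<partial>conv_power M n)"
        by (rule nn_integral_cong_AE) (use Suc elim in \<open>auto elim!: eventually_mono\<close>)
      thus ?case by simp
    qed
  qed
  finally have z: "(\<integral>\<^sup>+z. indicator {..<0} z \<partial>conv_power M (Suc n)) = 0" by simp
  have "AE z in conv_power M (Suc n). indicator {..<0} z = (0 :: ennreal)"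
    by (rule nn_integral_0_iff_AE[THEN iffD1, OF _ z]) (simp del: conv_power.simps cong: measurable_cong_sets add: s measurable_cong_sets[OF s refl])
  thus ?case by eventually_elim (auto simp: indicator_def not_less split: if_splits)
qed

lemma nn_integral_exp_conv_power:
  assumes nonneg: "AE x in M. 0 \<le> x" and s: "0 < s"
  shows "(\<integral>\<^sup>+x. ennreal (exp (- (s * x))) \<partial>conv_power M n) = ennreal ((LINT x|M. exp (- (s * x))) ^ n)"
proof (induction n)
  case 0
  show ?case by (simp add: nn_integral_return)
next
  case (Suc n)
  note i1 = integrable_exp_minus[OF nonneg s]
  have fin: "finite_measure M" "finite_measure (conv_power M n)" 
    by (auto intro!: prob_space.finite_measure prob_space_conv_power prob_space_axioms)
  note sets = sets_conv_power[OF prob_space_axioms events_eq_borel]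
  note [measurable_cong] = sets
  have "(\<integral>\<^sup>+x. ennreal (exp (- (s * x))) \<partial>conv_power M (Suc n)) =
     (\<integral>\<^sup>+x. \<integral>\<^sup>+y. ennreal (exp (- (s * (x + y)))) \<partial>conv_power M n \<partial>M)"
    unfolding conv_power.simps by (rule nn_integral_convolution[OF fin sets events_eq_borel]) simp
  also have "\<dots> = (\<integral>\<^sup>+x. ennreal (exp (- (s * x))) * ennreal ((LINT x|M. exp (- (s * x))) ^ n) \<partial>M)"
    unfolding Suc[symmetric]
    by (intro nn_integral_cong) (auto simp: nn_integral_cmult[symmetric] algebra_simps exp_add exp_diff exp_minus ennreal_mult divide_inverse)
  also have "\<dots> = (\<integral>\<^sup>+x. ennreal (exp (- (s * x))) \<partial>M) * ennreal ((LINT x|M. exp (- (s * x))) ^ n)"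
    by (rule nn_integral_multc) simp
  also have "(\<integral>\<^sup>+x. ennreal (exp (- (s * x))) \<partial>M) = ennreal (LINT x|M. exp (- (s * x)))"
    by (rule nn_integral_eq_integral[OF i1]) simp
  finally show ?case by (simp add: ennreal_mult' del: conv_power.simps)
qed

text \<open>
  The product rule \<open>(x + y) exp (- s (x + y)) = x exp (- s x) exp (- s y) + exp (- s x) y exp (- s y)\<close>
  turns one more convolution factor into one more summand, so that the moment is minus the
  derivative of the \<open>n\<close>-th power of the Laplace transform.
\<close>

lemma nn_integral_mult_exp_conv_power:
  assumes nonneg: "AE x in M. 0 \<le> x" and s: "0 < s" and int: "integrable M (\<lambda>x. x)"
  shows "(\<integral>\<^sup>+x. ennreal (x * exp (- (s * x))) \<partial>conv_power M (Suc n)) =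
     ennreal (real (Suc n) * (LINT x|M. exp (- (s * x))) ^ n * (LINT x|M. x * exp (- (s * x))))"
    (is "?I (Suc n) = ennreal (real (Suc n) * ?F ^ n * ?m)")
proof -
  note i1 = integrable_exp_minus[OF nonneg s]
  note i2 = integrable_mult_exp_minus[OF nonneg int s]
  have m: "(\<integral>\<^sup>+x. ennreal (x * exp (- (s * x))) \<partial>M) = ennreal ?m"
    by (rule nn_integral_eq_integral[OF i2]) (use nonneg in \<open>auto elim!: eventually_mono\<close>)
  have e: "(\<integral>\<^sup>+x. ennreal (exp (- (s * x))) \<partial>M) = ennreal ?F"
    by (rule nn_integral_eq_integral[OF i1]) simp
  have m0: "?m \<ge> 0" by (rule integral_nonneg_AE) (use nonneg in \<open>auto elim!: eventually_mono\<close>)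
  have F0: "?F \<ge> 0" by (rule integral_nonneg_AE) simp
  note sets = sets_conv_power[OF prob_space_axioms events_eq_borel]
  have step: "?I (Suc n) = ennreal ?m * ennreal (?F ^ n) + ennreal ?F * ?I n" for n
  proof -
    have fin: "finite_measure M" "finite_measure (conv_power M n)" 
      by (auto intro!: prob_space.finite_measure prob_space_conv_power prob_space_axioms)
    note [measurable_cong] = sets
    have "?I (Suc n) = (\<integral>\<^sup>+x. \<integral>\<^sup>+y. ennreal ((x + y) * exp (- (s * (x + y)))) \<partial>conv_power M n \<partial>M)"
      unfolding conv_power.simps by (rule nn_integral_convolution[OF fin sets events_eq_borel]) simp
    also have "\<dots> = (\<integral>\<^sup>+x. ennreal (x * exp (- (s * x))) * ennreal (?F ^ n) + ennreal (exp (- (s * x))) * ?I n \<partial>M)"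
    proof (rule nn_integral_cong_AE)
      show "AE x in M. (\<integral>\<^sup>+y. ennreal ((x + y) * exp (- (s * (x + y)))) \<partial>conv_power M n) =
          ennreal (x * exp (- (s * x))) * ennreal (?F ^ n) + ennreal (exp (- (s * x))) * ?I n"
        using nonneg
      proof eventually_elim
        case (elim x)
        have "(\<integral>\<^sup>+y. ennreal ((x + y) * exp (- (s * (x + y)))) \<partial>conv_power M n) =
          (\<integral>\<^sup>+y. ennreal (x * exp (- (s * x))) * ennreal (exp (- (s * y))) +
                 ennreal (exp (- (s * x))) * ennreal (y * exp (- (s * y))) \<partial>conv_power M n)"
        proof (rule nn_integral_cong_AE)
          show "AE y in conv_power M n. ennreal ((x + y) * exp (- (s * (x + y)))) =
             ennreal (x * exp (- (s * x))) * ennreal (exp (- (s * y))) +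
                 ennreal (exp (- (s * x))) * ennreal (y * exp (- (s * y)))"
            using AE_conv_power_nonneg[OF nonneg, of n]
          proof eventually_elim
            case (elim y)
            have "(x + y) * exp (- (s * (x + y))) = (x * exp (- (s * x))) * exp (- (s * y)) + exp (- (s * x)) * (y * exp (- (s * y)))"
              by (simp add: ring_distribs exp_diff exp_minus field_simps)
            thus ?case using elim \<open>0 \<le> x\<close> by (simp add: ennreal_mult ennreal_plus)
          qed
        qed
        also have "\<dots> = ennreal (x * exp (- (s * x))) * (\<integral>\<^sup>+y. ennreal (exp (- (s * y))) \<partial>conv_power M n) +
                 ennreal (exp (- (s * x))) * ?I n"
          by (simp add: nn_integral_add nn_integral_cmult)
        finally show ?case unfolding nn_integral_exp_conv_power[OF nonneg s] .
      qed
    qed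
    also have "\<dots> = (\<integral>\<^sup>+x. ennreal (x * exp (- (s * x))) \<partial>M) * ennreal (?F ^ n) + (\<integral>\<^sup>+x. ennreal (exp (- (s * x))) \<partial>M) * ?I n"
      by (simp add: nn_integral_add nn_integral_multc)
    finally show ?thesis unfolding m e .
  qed
  have I0: "?I 0 = 0" by (simp add: nn_integral_return)
  show ?thesis
  proof (induction n)
    case 0
    show ?case using step[of 0] I0 by simp
  next
    case (Suc n)
    have "?I (Suc (Suc n)) = ennreal ?m * ennreal (?F ^ Suc n) + ennreal ?F * ennreal (real (Suc n) * ?F ^ n * ?m)"
      unfolding step[of "Suc n"] Suc ..
    also have "\<dots> = ennreal (?m * ?F ^ Suc n + ?F * (real (Suc n) * ?F ^ n * ?m))"
      using m0 F0 by (subst ennreal_plus) (auto simp: ennreal_mult)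
    also have "?m * ?F ^ Suc n + ?F * (real (Suc n) * ?F ^ n * ?m) = real (Suc (Suc n)) * ?F ^ Suc n * ?m"
      by (simp add: algebra_simps)
    finally show ?case .
  qed
qed

lemma Laplace_less_1:
  assumes nonneg: "AE x in M. 0 \<le> x" and mean: "0 < (LINT x|M. x)" and s: "s > 0"
  shows "(LINT x|M. exp (- (s * x))) < 1"
proof -
  note i1 = integrable_exp_minus[OF nonneg s]
  have i: "(LINT x|M. 1 - exp (- (s * x))) = 1 - (LINT x|M. exp (- (s * x)))"
    using i1 by (simp add: prob_space[unfolded space_eq_univ])
  have nn: "AE x in M. 0 \<le> 1 - exp (- (s * x))"
    using nonneg by eventually_elim (use s in simp)
  have "(LINT x|M. 1 - exp (- (s * x))) \<ge> 0" by (rule integral_nonneg_AE[OF nn])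
  moreover have "(LINT x|M. 1 - exp (- (s * x))) \<noteq> 0"
  proof
    assume "(LINT x|M. 1 - exp (- (s * x))) = 0"
    hence "AE x in M. 1 - exp (- (s * x)) = 0"
      using integral_nonneg_eq_0_iff_AE[OF _ nn] i1 by auto
    hence "AE x in M. x = 0" by eventually_elim (use s in simp)
    hence "(LINT x|M. x) = (LINT x|M. 0)" by (intro integral_cong_AE) auto
    thus False using mean by simp
  qed
  ultimately show ?thesis using i by linarith
qed

end

text \<open>
  On \<open>[0, N]\<close> the positive and the negative part of \<open>d\<close> are densities of finite measures with the
  same distribution function, hence of the same measure.
\<close>

lemma AE_eq_0_if_interval_integrals_0:
  fixes d :: "real \<Rightarrow> real"
  assumes int: "\<And>t. t \<ge> 0 \<Longrightarrow> set_integrable lborel {0..t} d"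
    and zero: "\<And>t. t \<ge> 0 \<Longrightarrow> (LINT x:{0..t}|lborel. d x) = 0"
  shows "AE x in lborel. 0 \<le> x \<longrightarrow> d x = 0"
proof -
  have "AE x in lborel. x \<in> {0..real N} \<longrightarrow> d x = 0" for N
  proof -
    define e where "e x = d x * indicator {0..real N} x" for x
    have ie: "integrable lborel e"
      using int[of "real N"] unfolding e_def set_integrable_def by (simp add: mult.commute)
    note [measurable] = borel_measurable_integrable[OF ie]
    define p n where "p x = max 0 (e x)" and "n x = max 0 (- e x)" for x
    have ip: "integrable lborel p" and "in": "integrable lborel n"
      unfolding p_def n_def using ie by auto
    note [measurable] = borel_measurable_integrable[OF ip] borel_measurable_integrable[OF "in"]
    have fin: "finite_borel_measure (density lborel (\<lambda>x. ennreal (q x)))"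
      if "integrable lborel q" "\<And>x. q x \<ge> 0" for q :: "real \<Rightarrow> real"
    proof -
      have [measurable]: "q \<in> borel_measurable borel" using that(1) by auto
      show ?thesis
      proof (intro finite_borel_measure.intro finite_borel_measure_axioms.intro finite_measureI)
        show "emeasure (density lborel (\<lambda>x. ennreal (q x))) (space (density lborel (\<lambda>x. ennreal (q x)))) \<noteq> \<infinity>"
          using nn_integral_eq_integral[OF that(1)] that(2) by (simp add: emeasure_density)
      qed simp
    qed
    have m: "measure (density lborel (\<lambda>x. ennreal (q x))) {..t} = (LINT x|lborel. q x * indicator {..t} x)"
      if "integrable lborel q" "\<And>x. q x \<ge> 0" for q :: "real \<Rightarrow> real" and t
    proof -
      have [measurable]: "q \<in> borel_measurable borel" using that(1) by auto
      have i: "integrable lborel (\<lambda>x. q x * indicator {..t} x)"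
        by (rule integrable_real_mult_indicator) (use that in \<open>simp_all add: atMost_borel\<close>)
      have "emeasure (density lborel (\<lambda>x. ennreal (q x))) {..t} = (\<integral>\<^sup>+x. ennreal (q x * indicator {..t} x) \<partial>lborel)"
        by (simp add: emeasure_density ennreal_mult'' flip: ennreal_indicator)
      also have "\<dots> = ennreal (LINT x|lborel. q x * indicator {..t} x)"
        by (rule nn_integral_eq_integral[OF i]) (simp add: that)
      finally show ?thesis by (simp add: measure_def that integral_nonneg_AE)
    qed
    have "cdf (density lborel (\<lambda>x. ennreal (p x))) = cdf (density lborel (\<lambda>x. ennreal (n x)))"
    proof
      fix t
      have i: "integrable lborel (\<lambda>x. q x * indicator {..t} x)" if "integrable lborel q" for q :: "real \<Rightarrow> real"
        by (rule integrable_real_mult_indicator) (use that in \<open>simp_all add: atMost_borel\<close>)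
      have "(LINT x|lborel. p x * indicator {..t} x) - (LINT x|lborel. n x * indicator {..t} x) =
         (LINT x|lborel. p x * indicator {..t} x - n x * indicator {..t} x)"
        by (rule Bochner_Integration.integral_diff[symmetric]) (intro i ip "in")+
      also have "\<dots> = (LINT x|lborel. indicator {0..min t (real N)} x *\<^sub>R d x)"
        by (intro Bochner_Integration.integral_cong) (auto simp: p_def n_def e_def split: split_indicator)
      also have "\<dots> = 0"
      proof (cases "min t (real N) \<ge> 0")
        case True
        thus ?thesis using zero[OF True] by (simp add: set_lebesgue_integral_def)
      next
        case False
        hence "{0..min t (real N)} = {}" by auto
        thus ?thesis by simp
      qed
      finally show "cdf (density lborel (\<lambda>x. ennreal (p x))) t = cdf (density lborel (\<lambda>x. ennreal (n x))) t"
        unfolding cdf_def by (subst (1 2) m) (auto simp: ip "in" p_def n_def)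
    qed
    moreover have "finite_borel_measure (density lborel (\<lambda>x. ennreal (p x)))"
      by (rule fin[OF ip]) (simp add: p_def)
    moreover have "finite_borel_measure (density lborel (\<lambda>x. ennreal (n x)))"
      by (rule fin[OF "in"]) (simp add: n_def)
    ultimately have "density lborel (\<lambda>x. ennreal (p x)) = density lborel (\<lambda>x. ennreal (n x))"
      by (intro cdf_unique')
    hence "AE x in lborel. ennreal (p x) = ennreal (n x)"
      by (intro sigma_finite_measure.density_unique[OF sigma_finite_lborel]) auto
    thus ?thesis
      by eventually_elim (auto simp: p_def n_def e_def max_def split: if_splits)
  qed
  hence "AE x in lborel. \<forall>N. x \<in> {0..real N} \<longrightarrow> d x = 0" by (subst AE_all_countable) auto
  thus ?thesis
  proof eventually_elim
    case (elim x)
    thus ?case using real_arch_simple[of x] by auto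
  qed
qed

text \<open>
  All convolution powers but the zeroth have densities, and \<open>v\<close> is their sum. Unlike an arbitrary
  version of the renewal density, \<open>v\<close> is nonnegative and can be integrated term by term. The
  estimate \<open>F\<^sup>*\<^sup>n(t) \<le> exp t (E exp (- X))^n\<close> makes the renewal series converge.
\<close>

lemma (in real_distribution) nonneg_renewal_density:
  fixes f :: "real \<Rightarrow> ennreal"
  assumes nonneg: "AE x in M. 0 \<le> x" and mean: "0 < (LINT x|M. x)"
    and M: "M = density lborel f" and f: "f \<in> borel_measurable borel"
  obtains v :: "real \<Rightarrow> real" where
    "v \<in> borel_measurable borel" "\<And>x. 0 \<le> v x"
    "\<And>h. h \<in> borel_measurable borel \<Longrightarrow>
        (\<integral>\<^sup>+x. h x * ennreal (v x) \<partial>lborel) = (\<Sum>n. \<integral>\<^sup>+x. h x \<partial>conv_power M (Suc n))"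
    "\<And>t. 0 \<le> t \<Longrightarrow> has_bochner_integral lborel (\<lambda>x. v x * indicator {0..t} x) (renewal_function M t - 1)"
proof -
  note sets = sets_conv_power[OF prob_space_axioms events_eq_borel]
  have prob: "prob_space (conv_power M n)" for n
    by (rule prob_space_conv_power[OF prob_space_axioms events_eq_borel])
  obtain g where g[measurable]: "\<And>n. g n \<in> borel_measurable borel"
    and gd: "\<And>n. conv_power M (Suc n) = density lborel (g n)"
    using conv_power_density[OF M f prob_space_axioms] by metis
  define V where "V x = (\<Sum>n. g n x)" for x
  have V[measurable]: "V \<in> borel_measurable borel" unfolding V_def by measurable
  have int_V: "(\<integral>\<^sup>+x. h x * V x \<partial>lborel) = (\<Sum>n. \<integral>\<^sup>+x. h x \<partial>conv_power M (Suc n))"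
    if [measurable]: "h \<in> borel_measurable borel" for h
  proof -
    have "(\<integral>\<^sup>+x. h x * V x \<partial>lborel) = (\<integral>\<^sup>+x. (\<Sum>n. g n x * h x) \<partial>lborel)"
      unfolding V_def by (intro nn_integral_cong) (simp add: ennreal_suminf_multc mult.commute)
    also have "\<dots> = (\<Sum>n. \<integral>\<^sup>+x. g n x * h x \<partial>lborel)" by (rule nn_integral_suminf) simp
    also have "\<dots> = (\<Sum>n. \<integral>\<^sup>+x. h x \<partial>conv_power M (Suc n))"
      unfolding gd by (simp add: nn_integral_density)
    finally show ?thesis .
  qed
  define F where "F = (LINT x|M. exp (- (1 * x)))"
  have F: "0 \<le> F" "F < 1" unfolding F_def
    by (auto intro!: integral_nonneg_AE Laplace_less_1[OF nonneg mean, of 1, simplified])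
  have cdf_le: "cdf (conv_power M n) t \<le> exp t * F ^ n" for n t
  proof -
    interpret N: prob_space "conv_power M n" by (rule prob)
    have "ennreal (cdf (conv_power M n) t) = (\<integral>\<^sup>+x. indicator {..t} x \<partial>conv_power M n)"
      by (simp add: cdf_def N.emeasure_eq_measure sets)
    also have "\<dots> \<le> (\<integral>\<^sup>+x. ennreal (exp t) * ennreal (exp (- (1 * x))) \<partial>conv_power M n)"
    proof (rule nn_integral_mono)
      fix x :: real
      have "1 \<le> exp t * exp (- (1 * x))" if "x \<le> t" using that by (simp flip: exp_add)
      hence "ennreal 1 \<le> ennreal (exp t) * ennreal (exp (- (1 * x)))" if "x \<le> t"
        using that by (subst ennreal_mult[symmetric]) (auto intro!: ennreal_leI)
      thus "indicator {..t} x \<le> ennreal (exp t) * ennreal (exp (- (1 * x)))" by (simp split: split_indicator)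
    qed
    also have "\<dots> = ennreal (exp t) * ennreal (F ^ n)"
      unfolding F_def nn_integral_exp_conv_power[OF nonneg zero_less_one, symmetric]
      by (rule nn_integral_cmult) (simp add: measurable_cong_sets[OF sets refl])
    also have "\<dots> = ennreal (exp t * F ^ n)" using F by (simp add: ennreal_mult)
    finally show ?thesis using F by (simp add: ennreal_le_iff)
  qed
  have cdf0: "0 \<le> cdf (conv_power M n) t" for n t by (simp add: cdf_def)
  have summable: "summable (\<lambda>n. cdf (conv_power M n) t)" for t
  proof (rule summable_comparison_test')
    show "summable (\<lambda>n. exp t * F ^ n)" using F by (intro summable_mult summable_geometric) simp
    show "norm (cdf (conv_power M n) t) \<le> exp t * F ^ n" for n using cdf0 cdf_le by simp
  qed
  have U: "(\<integral>\<^sup>+x. indicator {0..t} x * V x \<partial>lborel) = ennreal (renewal_function M t - 1)"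
    and U0: "0 \<le> renewal_function M t - 1" if t: "0 \<le> t" for t
  proof -
    have c0: "cdf (conv_power M 0) t = 1" using t by (simp add: cdf_def measure_return)
    have summable_Suc: "summable (\<lambda>n. cdf (conv_power M (Suc n)) t)"
      using summable_ignore_initial_segment[OF summable[of t], of 1] by (simp del: conv_power.simps)
    have s: "(\<Sum>n. cdf (conv_power M (Suc n)) t) = renewal_function M t - 1"
      using suminf_split_head[OF summable, of t] c0 unfolding renewal_function_def by simp
    have "(\<integral>\<^sup>+x. indicator {0..t} x * V x \<partial>lborel) = (\<Sum>n. \<integral>\<^sup>+x. indicator {0..t} x \<partial>conv_power M (Suc n))"
      by (rule int_V) simp
    also have "\<dots> = (\<Sum>n. ennreal (cdf (conv_power M (Suc n)) t))"
    proof (rule suminf_cong)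
      fix n
      interpret N: prob_space "conv_power M (Suc n)" by (rule prob)
      have "(\<integral>\<^sup>+x. indicator {0..t} x \<partial>conv_power M (Suc n)) = (\<integral>\<^sup>+x. indicator {..t} x \<partial>conv_power M (Suc n))"
        by (rule nn_integral_cong_AE)
           (use AE_conv_power_nonneg[OF nonneg, of "Suc n"] in \<open>auto elim!: eventually_mono split: split_indicator simp del: conv_power.simps\<close>)
      also have "\<dots> = ennreal (cdf (conv_power M (Suc n)) t)"
        unfolding cdf_def N.emeasure_eq_measure[symmetric] by (rule nn_integral_indicator) (simp add: sets del: conv_power.simps)
      finally show "(\<integral>\<^sup>+x. indicator {0..t} x \<partial>conv_power M (Suc n)) = ennreal (cdf (conv_power M (Suc n)) t)" .
    qed
    also have "\<dots> = ennreal (\<Sum>n. cdf (conv_power M (Suc n)) t)"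
      by (rule suminf_ennreal2[OF cdf0 summable_Suc])
    finally show "(\<integral>\<^sup>+x. indicator {0..t} x * V x \<partial>lborel) = ennreal (renewal_function M t - 1)" unfolding s .
    show "0 \<le> renewal_function M t - 1" unfolding s[symmetric]
      by (rule suminf_nonneg[OF summable_Suc cdf0])
  qed
  have neg: "AE x in lborel. x < 0 \<longrightarrow> V x = 0"
  proof -
    have "(\<integral>\<^sup>+x. indicator {..<0} x * V x \<partial>lborel) = (\<Sum>n. \<integral>\<^sup>+x. indicator {..<0} x \<partial>conv_power M (Suc n))"
      by (rule int_V) simp
    also have "\<dots> = (\<Sum>n. 0)"
    proof (rule suminf_cong)
      fix n
      have "(\<integral>\<^sup>+x. indicator {..<0} x \<partial>conv_power M (Suc n)) = (\<integral>\<^sup>+x. 0 \<partial>conv_power M (Suc n))"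
        by (rule nn_integral_cong_AE)
           (use AE_conv_power_nonneg[OF nonneg, of "Suc n"] in \<open>auto elim!: eventually_mono split: split_indicator simp del: conv_power.simps\<close>)
      thus "(\<integral>\<^sup>+x. indicator {..<0} x \<partial>conv_power M (Suc n)) = 0" by simp
    qed
    finally have "AE x in lborel. indicator {..<0} x * V x = 0"
      by (subst nn_integral_0_iff_AE[symmetric]) auto
    thus ?thesis by eventually_elim auto
  qed
  have fin: "AE x in lborel. V x \<noteq> \<infinity>"
  proof -
    have "AE x in lborel. indicator {0..real N} x * V x \<noteq> \<infinity>" for N
      by (rule nn_integral_PInf_AE) (use U[of "real N"] in auto)
    hence "AE x in lborel. \<forall>N. indicator {0..real N} x * V x \<noteq> \<infinity>" by (subst AE_all_countable) auto
    thus ?thesis using neg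
    proof eventually_elim
      case (elim x)
      obtain N where N: "x \<le> real N" using real_arch_simple by blast
      show ?case
      proof (cases "x < 0")
        case False
        thus ?thesis using elim(1)[rule_format, of N] N by simp
      qed (use elim in simp)
    qed
  qed
  define v where "v x = enn2real (V x)" for x
  have vV: "AE x in lborel. ennreal (v x) = V x"
    using fin by eventually_elim (simp add: v_def top.not_eq_extremum)
  have v[measurable]: "v \<in> borel_measurable borel" unfolding v_def by measurable
  have v0: "0 \<le> v x" for x by (simp add: v_def)
  have vh: "(\<integral>\<^sup>+x. h x * ennreal (v x) \<partial>lborel) = (\<integral>\<^sup>+x. h x * V x \<partial>lborel)" for h
    by (rule nn_integral_cong_AE) (use vV in \<open>auto elim!: eventually_mono\<close>)
  show ?thesis
  proof (rule that[OF v v0])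
    show "(\<integral>\<^sup>+x. h x * ennreal (v x) \<partial>lborel) = (\<Sum>n. \<integral>\<^sup>+x. h x \<partial>conv_power M (Suc n))"
      if "h \<in> borel_measurable borel" for h
      unfolding vh by (rule int_V[OF that])
    show "has_bochner_integral lborel (\<lambda>x. v x * indicator {0..t} x) (renewal_function M t - 1)" if t: "0 \<le> t" for t
    proof (rule has_bochner_integral_nn_integral)
      have "(\<integral>\<^sup>+x. ennreal (v x * indicator {0..t} x) \<partial>lborel) = (\<integral>\<^sup>+x. indicator {0..t} x * ennreal (v x) \<partial>lborel)"
        by (intro nn_integral_cong) (simp split: split_indicator)
      thus "(\<integral>\<^sup>+x. ennreal (v x * indicator {0..t} x) \<partial>lborel) = ennreal (renewal_function M t - 1)"
        using U[OF t] vh by simp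
    qed (use U0[OF t] v0 in auto)
  qed
qed

text \<open>
  Every version \<open>u\<close> agrees with the sum of the densities almost everywhere on the half-line, and that sum
  leads to the differentiated geometric series \<open>\<Sum>n. (n + 1) z^n = 1 / (1 - z)\<^sup>2\<close>.
\<close>

lemma (in real_distribution) Laplace_mult_renewal_density:
  fixes f :: "real \<Rightarrow> ennreal"
  assumes nonneg: "AE x in M. 0 \<le> x" and int: "integrable M (\<lambda>x. x)" and mean: "0 < (LINT x|M. x)"
    and M: "M = density lborel f" and f: "f \<in> borel_measurable borel"
    and u: "renewal_density M u" and s: "s > 0"
  shows "has_bochner_integral lborel (\<lambda>x. exp (- (s * x)) * (x * u x * indicator {0..} x))
           ((LINT x|M. x * exp (- (s * x))) / (1 - (LINT x|M. exp (- (s * x))))\<^sup>2)"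
    (is "has_bochner_integral _ _ (?m / (1 - ?F)\<^sup>2)")
proof -
  obtain v where v[measurable]: "v \<in> borel_measurable borel" and v0: "\<And>x. 0 \<le> v x"
    and int_v: "\<And>h. h \<in> borel_measurable borel \<Longrightarrow>
        (\<integral>\<^sup>+x. h x * ennreal (v x) \<partial>lborel) = (\<Sum>n. \<integral>\<^sup>+x. h x \<partial>conv_power M (Suc n))"
    and v_t: "\<And>t. 0 \<le> t \<Longrightarrow> has_bochner_integral lborel (\<lambda>x. v x * indicator {0..t} x) (renewal_function M t - 1)"
    using nonneg_renewal_density[OF nonneg mean M f] by blast
  have F: "0 \<le> ?F" "?F < 1"
    by (auto intro!: integral_nonneg_AE Laplace_less_1[OF nonneg mean s])
  have m0: "?m \<ge> 0" by (rule integral_nonneg_AE) (use nonneg in \<open>auto elim!: eventually_mono\<close>)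
  have v_set: "set_integrable lborel {0..t} v" "(LINT x:{0..t}|lborel. v x) = renewal_function M t - 1" if "0 \<le> t" for t
    using v_t[OF that] by (auto simp: has_bochner_integral_iff set_integrable_def set_lebesgue_integral_def mult.commute)
  have u_set: "set_integrable lborel {0..t} u" "(LINT x:{0..t}|lborel. u x) = renewal_function M t - 1" if "0 \<le> t" for t
    using u that unfolding renewal_density_def by auto
  have uv: "AE x in lborel. 0 \<le> x \<longrightarrow> u x - v x = 0"
  proof (rule AE_eq_0_if_interval_integrals_0)
    fix t :: real assume t: "t \<ge> 0"
    show "set_integrable lborel {0..t} (\<lambda>x. u x - v x)"
      using u_set(1)[OF t] v_set(1)[OF t] by (rule set_integral_diff)
    show "(LINT x:{0..t}|lborel. u x - v x) = 0"
      using set_integral_diff(2)[OF u_set(1)[OF t] v_set(1)[OF t]] u_set(2)[OF t] v_set(2)[OF t] by simp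
  qed
  have [measurable]: "(\<lambda>x. u x * indicator {0..} x) \<in> borel_measurable borel"
  proof (rule borel_measurable_LIMSEQ_real)
    show "(\<lambda>x. u x * indicator {0..real n} x) \<in> borel_measurable borel" for n
      using borel_measurable_integrable[OF u_set(1)[of "real n", unfolded set_integrable_def]] by (simp add: mult.commute)
    show "(\<lambda>n. u x * indicator {0..real n} x) \<longlonglongrightarrow> u x * indicator {0..} x" for x
    proof (rule tendsto_eventually)
      obtain N where "x \<le> real N" using real_arch_simple by blast
      hence "\<forall>n\<ge>N. u x * indicator {0..real n} x = u x * indicator {0..} x"
        by (auto split: split_indicator)
      thus "\<forall>\<^sub>F n in sequentially. u x * indicator {0..real n} x = u x * indicator {0..} x"
        by (auto simp: eventually_sequentially)
    qed
  qed
  have "(\<lambda>n. of_nat (Suc n) * ?F ^ n) sums (1 / (1 - ?F)\<^sup>2)"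
    by (rule geometric_deriv_sums) (use F in simp)
  from sums_mult2[OF this, of ?m]
  have sums: "(\<lambda>n. real (Suc n) * ?F ^ n * ?m) sums (?m / (1 - ?F)\<^sup>2)" by simp
  have "has_bochner_integral lborel (\<lambda>x. exp (- (s * x)) * (x * v x * indicator {0..} x)) (?m / (1 - ?F)\<^sup>2)"
  proof (rule has_bochner_integral_nn_integral)
    have "(\<integral>\<^sup>+x. ennreal (exp (- (s * x)) * (x * v x * indicator {0..} x)) \<partial>lborel) =
        (\<integral>\<^sup>+x. ennreal (x * exp (- (s * x))) * ennreal (v x) \<partial>lborel)"
    proof (rule nn_integral_cong)
      fix x :: real
      show "ennreal (exp (- (s * x)) * (x * v x * indicator {0..} x)) = ennreal (x * exp (- (s * x))) * ennreal (v x)"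
      proof (cases "x \<ge> 0")
        case True
        thus ?thesis using v0[of x] by (simp add: ennreal_mult[symmetric] mult_ac)
      next
        case False
        hence "x * exp (- (s * x)) \<le> 0" by (intro mult_nonpos_nonneg) auto
        thus ?thesis using False by (simp add: ennreal_neg)
      qed
    qed
    also have "\<dots> = (\<Sum>n. \<integral>\<^sup>+x. ennreal (x * exp (- (s * x))) \<partial>conv_power M (Suc n))"
      by (rule int_v) simp
    also have "\<dots> = (\<Sum>n. ennreal (real (Suc n) * ?F ^ n * ?m))"
      unfolding nn_integral_mult_exp_conv_power[OF nonneg s int] ..
    also have "\<dots> = ennreal (?m / (1 - ?F)\<^sup>2)"
      by (rule suminf_ennreal_eq[OF _ sums]) (use m0 F in auto)
    finally show "(\<integral>\<^sup>+x. ennreal (exp (- (s * x)) * (x * v x * indicator {0..} x)) \<partial>lborel) = ennreal (?m / (1 - ?F)\<^sup>2)" .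
    show "AE x in lborel. 0 \<le> exp (- (s * x)) * (x * v x * indicator {0..} x)"
      using v0 by (intro AE_I2) (simp split: split_indicator)
    show "0 \<le> ?m / (1 - ?F)\<^sup>2" using m0 by simp
  qed simp
  moreover have "(\<lambda>x. exp (- (s * x)) * (x * (u x * indicator {0..} x))) \<in> borel_measurable lborel" by measurable
  hence "(\<lambda>x. exp (- (s * x)) * (x * u x * indicator {0..} x)) \<in> borel_measurable lborel" by (simp add: mult.assoc)
  ultimately show ?thesis
    by (subst has_bochner_integral_cong_AE[where g = "\<lambda>x. exp (- (s * x)) * (x * v x * indicator {0..} x)"])
       (use uv in \<open>auto elim!: eventually_mono split: split_indicator\<close>)
qed

section \<open>Asymptotics of the renewal density\<close>

theorem theorem5:
  fixes M :: "real measure" and f u L :: "real \<Rightarrow> real" and \<mu> :: real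
  assumes "real_distribution M"
    and "AE x in M. 0 \<le> x"
    and "nonlattice M"
    and "integrable M (\<lambda>x. x)" and "\<mu> = (LINT x|M. x)" and "0 < \<mu>"
    and "slowly_varying L"
    and "\<And>t. 0 < t \<Longrightarrow> 1 - cdf M t = L t / t\<^sup>2"
    and "integrable M (\<lambda>x. x\<^sup>2)"
    and "f \<in> borel_measurable borel" and "\<And>x. 0 \<le> f x"
    and "M = density lborel (\<lambda>x. ennreal (f x))"
    and "renewal_density M u"
    and "ultimately_monotone (\<lambda>t. u t - 1 / \<mu>)"
  shows "\<exists>L2 :: real \<Rightarrow> real.
           (\<forall>\<^sub>F t in at_top. u t = 1 / \<mu> + 1 / \<mu>\<^sup>2 * (L2 t / t)) \<and>
           ((\<lambda>t. L2 t / L t) \<longlongrightarrow> 1) at_top"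
proof -
  interpret real_distribution M by fact
  interpret slowly_varying_tail "\<lambda>x. 1 - cdf M x" L
  proof
    show "L t = t\<^sup>2 * (1 - cdf M t)" if "0 < t" for t using assms(8)[OF that] that by simp
    show "((\<lambda>t. L (c * t) / L t) \<longlongrightarrow> 1) at_top" if "c > 0" for c
      using assms(7) that unfolding slowly_varying_def by blast
  qed (use cdf_nondecreasing cdf_bounded_prob cdf_nonneg in auto)
  note nonneg = assms(2) and \<mu> = assms(5,6)
  have mean: "0 < (LINT x|M. x)" using \<mu> by simp
  define w where "w t = u t - 1 / \<mu>" for t
  obtain t0 where t0: "mono_on {t0..} w \<or> antimono_on {t0..} w"
    using assms(14) unfolding ultimately_monotone_def w_def[abs_def] by blast
  define r where "r t = t * L t" for t
  define \<mu>2 where "\<mu>2 = (LINT x|M. x\<^sup>2)"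
  define \<Phi> where "\<Phi> t = (LINT x|lborel. (1 - cdf M x) * erlang2 (x / t) * indicator {0..} x)" for t
  define P where "P t = t * (1 - (LINT x|M. exp (- (x / t))))" for t
  have r_top: "filterlim r at_top at_top" unfolding r_def by (rule times_L_at_top)
  have P_bound: "\<bar>\<mu> - P t\<bar> \<le> \<mu>2 / t" if "t > 0" for t
    using Laplace_first_order[OF nonneg assms(4,9), of "1 / t"] that
    by (simp add: P_def \<mu>(1) \<mu>2_def mult.commute)
  \<comment> \<open>The exact formula for the transform of \<open>x w(x)\<close>; here \<open>P t\<close> is the quantity \<open>(1 - \<phi>(s)) / s\<close> at \<open>s = 1 / t\<close>.\<close>
  have w_transform: "has_bochner_integral lborel (\<lambda>x. exp (- (x / t)) * (x * w x * indicator {0..} x))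
      (t\<^sup>2 * ((\<mu> * \<Phi> t - (\<mu> - P t)\<^sup>2) / (\<mu> * (P t)\<^sup>2)))" if t: "t > 0" for t
  proof -
    define m where "m = (LINT x|M. x * exp (- (1 / t * x)))"
    have s: "1 / t > 0" using t by simp
    have Ppos: "P t > 0"
      using Laplace_less_1[OF nonneg mean s] t by (simp add: P_def)
    have \<Phi>_eq: "\<Phi> t = \<mu> - 2 * P t + m"
      using expectation_erlang2_tail[OF nonneg assms(4) s] t
      by (simp add: \<Phi>_def P_def m_def \<mu>(1) mult.commute)
    have "has_bochner_integral lborel (\<lambda>x. exp (- (1 / t * x)) * (x * u x * indicator {0..} x)
             - 1 / \<mu> * (x * exp (- (1 / t * x)) * indicator {0..} x))
       (m / (1 - (LINT x|M. exp (- (1 / t * x))))\<^sup>2 - 1 / \<mu> * (1 / (1 / t)\<^sup>2))"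
      unfolding m_def
      by (intro has_bochner_integral_diff has_bochner_integral_mult_right has_bochner_integral_mult_exp_Ici[OF s]
          Laplace_mult_renewal_density[OF nonneg assms(4) mean assms(12) _ assms(13) s]) (use assms(10) in simp)
    also have "m / (1 - (LINT x|M. exp (- (1 / t * x))))\<^sup>2 - 1 / \<mu> * (1 / (1 / t)\<^sup>2) =
        t\<^sup>2 * (m / (P t)\<^sup>2 - 1 / \<mu>)"
    proof -
      have "P t = t * (1 - (LINT x|M. exp (- (1 / t * x))))" by (simp add: P_def)
      thus ?thesis using t by (simp only: power_mult_distrib right_diff_distrib[of "t\<^sup>2"]) (simp add: power_divide)
    qed
    also have "m / (P t)\<^sup>2 - 1 / \<mu> = (\<mu> * \<Phi> t - (\<mu> - P t)\<^sup>2) / (\<mu> * (P t)\<^sup>2)"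
      using Ppos \<mu>(2) unfolding \<Phi>_eq by (simp add: field_simps power2_eq_square)
    also have "(\<lambda>x. exp (- (1 / t * x)) * (x * u x * indicator {0..} x)
             - 1 / \<mu> * (x * exp (- (1 / t * x)) * indicator {0..} x)) =
        (\<lambda>x. exp (- (x / t)) * (x * w x * indicator {0..} x))"
      by (simp add: fun_eq_iff w_def algebra_simps)
    finally show ?thesis .
  qed
  have P_lim: "(P \<longlongrightarrow> \<mu>) at_top"
  proof -
    have "((\<lambda>t. \<mu> - P t) \<longlongrightarrow> 0) at_top"
    proof (rule Lim_null_comparison)
      show "\<forall>\<^sub>F t in at_top. norm (\<mu> - P t) \<le> \<mu>2 / t"
        using eventually_gt_at_top[of 0] by eventually_elim (simp add: P_bound)
      show "((\<lambda>t. \<mu>2 / t) \<longlongrightarrow> 0) at_top" by (rule real_tendsto_divide_at_top[OF tendsto_const filterlim_ident])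
    qed
    from tendsto_diff[OF tendsto_const[of \<mu>] this] show ?thesis by simp
  qed
  have \<Phi>_lim: "((\<lambda>t. t * \<Phi> t / L t) \<longlongrightarrow> 1) at_top"
    unfolding \<Phi>_def by (rule Abelian_erlang2)
  \<comment> \<open>The square is \<open>O(1 / t\<^sup>2)\<close>, and \<open>t L(t)\<close> tends to infinity.\<close>
  have square_lim: "((\<lambda>t. t * (\<mu> - P t)\<^sup>2 / L t) \<longlongrightarrow> 0) at_top"
  proof (rule Lim_null_comparison)
    show "((\<lambda>t. \<mu>2\<^sup>2 / r t) \<longlongrightarrow> 0) at_top" by (rule real_tendsto_divide_at_top[OF tendsto_const r_top])
    show "\<forall>\<^sub>F t in at_top. norm (t * (\<mu> - P t)\<^sup>2 / L t) \<le> \<mu>2\<^sup>2 / r t"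
      using eventually_gt_at_top[of 0] L_eventually_pos
    proof eventually_elim
      case (elim t)
      have "(\<mu> - P t)\<^sup>2 \<le> (\<mu>2 / t)\<^sup>2"
        using P_bound[OF elim(1)] by (metis abs_ge_zero power2_abs power_mono)
      hence "t * (\<mu> - P t)\<^sup>2 / L t \<le> t * (\<mu>2 / t)\<^sup>2 / L t"
        using elim by (intro divide_right_mono mult_left_mono) auto
      also have "\<dots> = \<mu>2\<^sup>2 / r t" using elim by (simp add: r_def field_simps power2_eq_square)
      finally show ?case using elim by simp
    qed
  qed
  have "((\<lambda>t. t\<^sup>2 * w t / r t) \<longlongrightarrow> 1 / \<mu>\<^sup>2) at_top"
  proof (rule monotone_density_Laplace[where r = r and ?t0.0 = t0])
    show "integrable lborel (\<lambda>x. exp (- (x / t)) * (x * w x * indicator {0..} x))" if "t > 0" for t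
      using w_transform[OF that] by (simp add: has_bochner_integral_iff)
    have "((\<lambda>t. (\<mu> * (t * \<Phi> t / L t) - t * (\<mu> - P t)\<^sup>2 / L t) / (\<mu> * (P t)\<^sup>2)) \<longlongrightarrow> (\<mu> * 1 - 0) / (\<mu> * \<mu>\<^sup>2)) at_top"
      using \<mu>(2) by (intro tendsto_intros \<Phi>_lim square_lim P_lim) simp
    moreover have "\<forall>\<^sub>F t in at_top. (\<mu> * (t * \<Phi> t / L t) - t * (\<mu> - P t)\<^sup>2 / L t) / (\<mu> * (P t)\<^sup>2) =
       (LINT x|lborel. exp (- (x / t)) * (x * w x * indicator {0..} x)) / r t"
      using eventually_gt_at_top[of 0]
    proof eventually_elim
      case (elim t)
      have "(LINT x|lborel. exp (- (x / t)) * (x * w x * indicator {0..} x)) / r t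
         = t\<^sup>2 * ((\<mu> * \<Phi> t - (\<mu> - P t)\<^sup>2) / (\<mu> * (P t)\<^sup>2)) / r t"
        using has_bochner_integral_integral_eq[OF w_transform[OF elim]] by simp
      also have "\<dots> = (\<mu> * (t * \<Phi> t / L t) - t * (\<mu> - P t)\<^sup>2 / L t) / (\<mu> * (P t)\<^sup>2)"
      proof -
        have "t\<^sup>2 * ((a * b - c) / d) / (t * l) = (a * (t * b / l) - t * c / l) / d" for a b c d l :: real
          using elim by (simp add: power2_eq_square right_diff_distrib diff_divide_distrib mult_ac)
        thus ?thesis unfolding r_def .
      qed
      finally show ?case ..
    qed
    ultimately have "((\<lambda>t. (LINT x|lborel. exp (- (x / t)) * (x * w x * indicator {0..} x)) / r t) \<longlongrightarrow> (\<mu> * 1 - 0) / (\<mu> * \<mu>\<^sup>2)) at_top"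
      by (rule Lim_transform_eventually)
    thus "((\<lambda>t. (LINT x|lborel. exp (- (x / t)) * (x * w x * indicator {0..} x)) / r t) \<longlongrightarrow> 1 / \<mu>\<^sup>2) at_top"
      using \<mu>(2) by simp
    show "((\<lambda>t. r (c * t) / r t) \<longlongrightarrow> c) at_top" if "c > 0" for c
    proof -
      have "((\<lambda>t. c * (L (c * t) / L t)) \<longlongrightarrow> c * 1) at_top" by (intro tendsto_intros L_slow that)
      moreover have "\<forall>\<^sub>F t in at_top. c * (L (c * t) / L t) = r (c * t) / r t"
        using eventually_gt_at_top[of 0] by eventually_elim (simp add: r_def)
      ultimately show ?thesis by (simp add: Lim_transform_eventually)
    qed
  qed (use \<mu>(2) r_top t0 in auto)
  hence "((\<lambda>t. \<mu>\<^sup>2 * (t\<^sup>2 * w t / r t)) \<longlongrightarrow> \<mu>\<^sup>2 * (1 / \<mu>\<^sup>2)) at_top"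
    by (rule tendsto_mult_left)
  moreover have "\<mu>\<^sup>2 * (1 / \<mu>\<^sup>2) = 1" using \<mu>(2) by simp
  ultimately have lim: "((\<lambda>t. \<mu>\<^sup>2 * (t\<^sup>2 * w t / r t)) \<longlongrightarrow> 1) at_top" by (simp only:)
  show ?thesis
  proof (intro exI[of _ "\<lambda>t. \<mu>\<^sup>2 * (t * w t)"] conjI)
    show "\<forall>\<^sub>F t in at_top. u t = 1 / \<mu> + 1 / \<mu>\<^sup>2 * (\<mu>\<^sup>2 * (t * w t) / t)"
      using eventually_gt_at_top[of 0] by eventually_elim (use \<mu>(2) in \<open>simp add: w_def\<close>)
    have "\<forall>\<^sub>F t in at_top. \<mu>\<^sup>2 * (t\<^sup>2 * w t / r t) = \<mu>\<^sup>2 * (t * w t) / L t"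
      using eventually_gt_at_top[of 0] by eventually_elim (simp add: r_def power2_eq_square)
    with lim show "((\<lambda>t. \<mu>\<^sup>2 * (t * w t) / L t) \<longlongrightarrow> 1) at_top" by (rule Lim_transform_eventually)
  qed
qed

end
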